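(* Let $\Gamma=(\mathcal V,\mathcal E,w)$ be a finite undirected graph without self-loops and with edge weights $w(e)>0$, whose node set is partitioned into load nodes $L$ and source nodes $S$, and let its weighted Laplacian matrix be $Y=\begin{pmatrix} Y_{LL} & Y_{LS} \\ Y_{SL} & Y_{SS} \end{pmatrix}$. Let $\mathcal V$ be partitioned into microgrids $\mathcal M_1,\dots,\mathcal M_k$ (numbered in this order), each containing at least one load node, and suppose that for every load node $v$ there is a path in $\Gamma$ from $v$ to a source node that descends the hierarchy of microgrids. Let $V_S>0$ be the vector of source voltages and $P_L>0$ the vector of load powers. Let $Y_{LL}=CDC^\top$ be the block Cholesky decomposition of $Y_{LL}$ with blocks given by the load nodes of $\mathcal M_1,\dots,\mathcal M_k$, and let $V_L^*:=-Y_{LL}^{-1}Y_{LS}V_S$. If $$D^{-1}C^{-1}[C^\top V_L^*]^{-1}P_L<\tfrac14\,C^\top V_L^*,$$ then $$Y_{LL}^{-1}[V_L^*]^{-1}P_L<\tfrac14 V_L^*$$ and $(Y_{LL},-Y_{LS}V_S,P_L)$ is feasible.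
   Context: All vectors and matrices are real. Inequalities between vectors or matrices are elementwise ($0$ also denotes the zero vector). For a vector $d$, $[d]:=\mathrm{diag}(d_1,\dots,d_n)$. Weighted Laplacian: $Y_{ij}=-w(\{i,j\})$ if $\{i,j\}\in\mathcal E$, $Y_{ij}=0$ if $i\ne j$ and $\{i,j\}\notin\mathcal E$, and $Y_{ii}=-\sum_{j\neq i}Y_{ij}$. The graph need not be connected. Path descending the hierarchy: a sequence of nodes $(v_1,\dots,v_l)$ with $\{v_r,v_{r+1}\}\in\mathcal E$ for $r=1,\dots,l-1$, such that whenever $v_p\in\mathcal M_s$, $v_q\in\mathcal M_t$ and $p<q$, then $s\ge t$. Feasible: for a square matrix $A$ and vectors $b\ge 0$, $c>0$, the triple $(A,b,c)$ is feasible if there is a vector $x>0$ with $[x]Ax-[b]x+c=0$. Block Cholesky decomposition (BCD): let $A$ be a symmetric positive definite matrix whose rows and columns are partitioned into $k$ nonempty blocks of sizes $n_1,\dots,n_k$, with blocks $a_{ij}\in\mathbb R^{n_i\times n_j}$. Let $A_i$ be the leading principal submatrix formed by blocks $1,\dots,i$, and $\alpha_i:=(a_{i1}\ \cdots\ a_{i,i-1})$. Define $C_1:=I_{n_1}$, $D_1:=a_{11}$, and for $i=2,\dots,k$ $$C_i:=\begin{pmatrix} C_{i-1} & 0 \\ \alpha_iA_{i-1}^{-1}C_{i-1} & I_{n_i} \end{pmatrix},\qquad D_i:=\begin{pmatrix} D_{i-1} & 0 \\ 0 & a_{ii}-\alpha_iA_{i-1}^{-1}\alpha_i^\top \end{pmatrix}.$$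 Then $A_i=C_iD_iC_i^\top$, and the BCD of $A$ is $A=CDC^\top$ with $C:=C_k$, $D:=D_k$. Here it is applied to $A=Y_{LL}$, with the load nodes ordered by microgrid; under the stated hypothesis $Y_{LL}$ is symmetric positive definite. *)

theory Defs
  imports
    "HOL-Library.Disjoint_Sets"
    "Jordan_Normal_Form.Gauss_Jordan_Elimination"
begin

text \<open>The library's \<open><\<close> on vectors only means \<open>v \<le> w \<and> \<not> w \<le> v\<close>; the order needed here is
  strict in every component.\<close>

definition vec_less :: "real vec \<Rightarrow> real vec \<Rightarrow> bool" (infix "<\<^sub>v" 50) where
  "u <\<^sub>v v \<longleftrightarrow> dim_vec u = dim_vec v \<and> (\<forall>i < dim_vec v. u $ i < v $ i)"

text \<open>Unspecified if \<open>A\<close> is singular.\<close>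

definition minv :: "real mat \<Rightarrow> real mat" where
  "minv A = the (mat_inverse A)"

definition diag_of_vec :: "real vec \<Rightarrow> real mat" where
  "diag_of_vec d = mat_diag (dim_vec d) (\<lambda>i. d $ i)"

definition feasible :: "real mat \<Rightarrow> real vec \<Rightarrow> real vec \<Rightarrow> bool" where
  "feasible A b c \<longleftrightarrow>
     (\<exists>n. A \<in> carrier_mat n n \<and> b \<in> carrier_vec n \<and> c \<in> carrier_vec n \<and>
          0\<^sub>v n \<le> b \<and> 0\<^sub>v n <\<^sub>v c \<and>
          (\<exists>x \<in> carrier_vec n. 0\<^sub>v n <\<^sub>v x \<and>
             diag_of_vec x *\<^sub>v (A *\<^sub>v x) - diag_of_vec b *\<^sub>v x + c = 0\<^sub>v n))"

definition weighted_graph :: "'v set \<Rightarrow> 'v set set \<Rightarrow> ('v set \<Rightarrow> real) \<Rightarrow> bool" where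
  "weighted_graph V E w \<longleftrightarrow>
     finite V \<and> E \<subseteq> {{u, v} | u v. u \<in> V \<and> v \<in> V \<and> u \<noteq> v} \<and> (\<forall>e \<in> E. 0 < w e)"

definition laplacian :: "'v set \<Rightarrow> 'v set set \<Rightarrow> ('v set \<Rightarrow> real) \<Rightarrow> 'v \<Rightarrow> 'v \<Rightarrow> real" where
  "laplacian V E w i j =
     (let y = (\<lambda>a b. if {a, b} \<in> E then - w {a, b} else 0)
      in if i = j then - (\<Sum>l \<in> V - {i}. y i l) else y i j)"

text \<open>The rows and columns are ordered as in the lists \<open>rs\<close> and \<open>cs\<close>.\<close>

definition matrix_on :: "'v list \<Rightarrow> 'v list \<Rightarrow> ('v \<Rightarrow> 'v \<Rightarrow> real) \<Rightarrow> real mat" where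
  "matrix_on rs cs Y = mat (length rs) (length cs) (\<lambda>(i, j). Y (rs ! i) (cs ! j))"

definition is_path :: "'v set \<Rightarrow> 'v set set \<Rightarrow> 'v list \<Rightarrow> bool" where
  "is_path V E p \<longleftrightarrow>
     p \<noteq> [] \<and> set p \<subseteq> V \<and> (\<forall>r. Suc r < length p \<longrightarrow> {p ! r, p ! Suc r} \<in> E)"

definition descends :: "nat \<Rightarrow> (nat \<Rightarrow> 'v set) \<Rightarrow> 'v list \<Rightarrow> bool" where
  "descends k M p \<longleftrightarrow>
     (\<forall>a b. \<forall>s \<in> {1..k}. \<forall>t \<in> {1..k}.
        a < b \<and> b < length p \<and> p ! a \<in> M s \<and> p ! b \<in> M t \<longrightarrow> s \<ge> t)"

definition ordered_by_microgrid :: "nat \<Rightarrow> (nat \<Rightarrow> 'v set) \<Rightarrow> 'v list \<Rightarrow> bool" where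
  "ordered_by_microgrid k M xs \<longleftrightarrow>
     (\<forall>a b. \<forall>s \<in> {1..k}. \<forall>t \<in> {1..k}.
        a < b \<and> b < length xs \<and> xs ! a \<in> M s \<and> xs ! b \<in> M t \<longrightarrow> s \<le> t)"

text \<open>Block Cholesky decomposition. The block sizes are \<open>n 1, n 2, \<dots>\<close>; blocks are numbered from
  \<open>1\<close>, whereas the entries of a matrix are indexed from \<open>0\<close>. Hence block \<open>i\<close> occupies the rows from
  \<open>offset n (i - 1)\<close> up to, but excluding, \<open>offset n i\<close>.\<close>

definition offset :: "(nat \<Rightarrow> nat) \<Rightarrow> nat \<Rightarrow> nat" where
  "offset n i = (\<Sum>j = 1..i. n j)"

definition block :: "real mat \<Rightarrow> (nat \<Rightarrow> nat) \<Rightarrow> nat \<Rightarrow> nat \<Rightarrow> real mat" where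
  "block A n i j =
     mat (n i) (n j) (\<lambda>(p, q). A $$ (offset n (i - 1) + p, offset n (j - 1) + q))"

definition leading :: "real mat \<Rightarrow> (nat \<Rightarrow> nat) \<Rightarrow> nat \<Rightarrow> real mat" where
  "leading A n i = mat (offset n i) (offset n i) (\<lambda>(p, q). A $$ (p, q))"

text \<open>The block row \<open>(a\<^sub>i\<^sub>1 \<dots> a\<^sub>i\<^sub>,\<^sub>i\<^sub>-\<^sub>1)\<close>.\<close>

definition alpha :: "real mat \<Rightarrow> (nat \<Rightarrow> nat) \<Rightarrow> nat \<Rightarrow> real mat" where
  "alpha A n i =
     mat (n i) (offset n (i - 1)) (\<lambda>(p, q). A $$ (offset n (i - 1) + p, q))"

text \<open>\<open>bcd_C A n i\<close> and \<open>bcd_D A n i\<close> are the factors \<open>C\<^sub>i\<close> and \<open>D\<^sub>i\<close> of \<open>leading A n i\<close>.\<close>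

fun bcd_C :: "real mat \<Rightarrow> (nat \<Rightarrow> nat) \<Rightarrow> nat \<Rightarrow> real mat" where
  "bcd_C A n 0 = 1\<^sub>m 0"
| "bcd_C A n (Suc 0) = 1\<^sub>m (n 1)"
| "bcd_C A n (Suc (Suc i)) =
     (let j = Suc i; m = Suc j in
      four_block_mat
        (bcd_C A n j)                                        (0\<^sub>m (offset n j) (n m))
        (alpha A n m * minv (leading A n j) * bcd_C A n j)   (1\<^sub>m (n m)))"

fun bcd_D :: "real mat \<Rightarrow> (nat \<Rightarrow> nat) \<Rightarrow> nat \<Rightarrow> real mat" where
  "bcd_D A n 0 = 1\<^sub>m 0"
| "bcd_D A n (Suc 0) = block A n 1 1"
| "bcd_D A n (Suc (Suc i)) =
     (let j = Suc i; m = Suc j in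
      four_block_mat
        (bcd_D A n j)                  (0\<^sub>m (offset n j) (n m))
        (0\<^sub>m (n m) (offset n j))
        (block A n m m - alpha A n m * minv (leading A n j) * transpose_mat (alpha A n m)))"

end

theory Submission
  imports Defs "Jordan_Normal_Form.Determinant"
begin

text \<open>Write \<open>A = Y\<^sub>L\<^sub>L\<close>, \<open>b = - Y\<^sub>L\<^sub>S V\<^sub>S\<close>, \<open>V = A\<^sup>-\<^sup>1 b\<close> and \<open>u = C\<^sup>T V\<close>. Since every
  load of the first \<open>i\<close> microgrids reaches a source through loads of these microgrids and sources
  only, the leading block \<open>A\<^sub>i\<close> satisfies a minimum principle: \<open>A\<^sub>i\<^sup>-\<^sup>1 \<ge> 0\<close> and
  \<open>A\<^sub>i\<^sup>-\<^sup>1 b\<^sub>i > 0\<close>, where \<open>b\<^sub>i\<close> is the corresponding part of \<open>b\<close>. The \<open>i\<close>-th block of \<open>u\<close> is the last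
  block of \<open>A\<^sub>i\<^sup>-\<^sup>1 b\<^sub>i\<close>, so \<open>u > 0\<close>; moreover \<open>D\<^sup>-\<^sup>1 \<ge> 0\<close> and \<open>C\<^sup>-\<^sup>1 \<ge> I\<close>. Hence
  \<open>V = C\<^sup>-\<^sup>T u \<ge> u > 0\<close>, so replacing \<open>[u]\<^sup>-\<^sup>1 P\<^sub>L\<close> by \<open>[V]\<^sup>-\<^sup>1 P\<^sub>L\<close> only decreases the left-hand side of the
  hypothesis, and applying \<open>C\<^sup>-\<^sup>T \<ge> I\<close> turns it into the claim because \<open>A\<^sup>-\<^sup>1 = C\<^sup>-\<^sup>T D\<^sup>-\<^sup>1 C\<^sup>-\<^sup>1\<close>.
  Feasibility follows by a monotone fixed point argument between \<open>V / 2\<close> and \<open>V\<close>.\<close>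

section \<open>Entrywise inequalities for matrices\<close>

text \<open>A right inverse of a square matrix over a field is two-sided, so \<open>A\<close> is a
  unit of the matrix ring and \<open>mat_inverse A\<close> cannot be \<open>None\<close>. This is
  what gives \<open>minv\<close> a meaning wherever it occurs.\<close>

lemma minv_props:
  assumes A: "A \<in> carrier_mat n n" and ex: "\<exists>B \<in> carrier_mat n n. A * B = 1\<^sub>m n"
  shows "minv A \<in> carrier_mat n n" "A * minv A = 1\<^sub>m n" "minv A * A = 1\<^sub>m n"
proof -
  obtain B where B: "B \<in> carrier_mat n n" "A * B = 1\<^sub>m n" using ex by blast
  have "B * A = 1\<^sub>m n" using mat_mult_left_right_inverse[OF A B] .
  then have "A \<in> Units (ring_mat TYPE(real) n undefined)"
    using A B by (auto simp: Units_def ring_mat_def)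
  with mat_inverse(1)[OF A] obtain C where C: "mat_inverse A = Some C" by fastforce
  from mat_inverse(2)[OF A C] C
  show "minv A \<in> carrier_mat n n" "A * minv A = 1\<^sub>m n" "minv A * A = 1\<^sub>m n"
    by (auto simp: minv_def)
qed

lemma inverse_mat_unique:
  assumes "A \<in> carrier_mat n n" "B \<in> carrier_mat n n" "B' \<in> carrier_mat n n"
    and "A * B = 1\<^sub>m n" "B' * A = (1\<^sub>m n :: real mat)"
  shows "B' = B"
  using assms by (metis assoc_mult_mat left_mult_one_mat right_mult_one_mat)

lemma minv_eqI:
  assumes A: "A \<in> carrier_mat n n" and B: "B \<in> carrier_mat n n" "A * B = 1\<^sub>m n"
  shows "minv A = B"
  using minv_props[OF A] B inverse_mat_unique[OF A B(1)] by metis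

lemma mult_mat_vec_sum:
  assumes "A \<in> carrier_mat nr nc" "x \<in> carrier_vec nc" "i < nr"
  shows "(A *\<^sub>v x) $ i = (\<Sum>j<nc. A $$ (i, j) * x $ j)"
  using assms by (simp add: scalar_prod_def lessThan_atLeast0)

lemma diag_of_vec_mult:
  assumes "d \<in> carrier_vec n" "z \<in> carrier_vec n"
  shows "diag_of_vec d *\<^sub>v z = vec n (\<lambda>i. d $ i * z $ i)"
proof (rule eq_vecI)
  fix i assume "i < dim_vec (vec n (\<lambda>i. d $ i * z $ i))"
  then have i: "i < n" by simp
  have D: "diag_of_vec d \<in> carrier_mat n n" using assms by (auto simp: diag_of_vec_def)
  have "(diag_of_vec d *\<^sub>v z) $ i = (\<Sum>j<n. if i = j then d $ j * z $ j else 0)"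
    unfolding mult_mat_vec_sum[OF D assms(2) i]
    using i assms by (intro sum.cong) (auto simp: diag_of_vec_def mat_diag_def)
  then show "(diag_of_vec d *\<^sub>v z) $ i = vec n (\<lambda>i. d $ i * z $ i) $ i" using i by simp
qed (use assms in \<open>auto simp: diag_of_vec_def mat_diag_def\<close>)

lemma minv_diag_of_vec:
  assumes d: "d \<in> carrier_vec n" "0\<^sub>v n <\<^sub>v d" and p: "p \<in> carrier_vec n"
  shows "minv (diag_of_vec d) *\<^sub>v p = vec n (\<lambda>i. p $ i / d $ i)"
proof -
  define e where "e = vec n (\<lambda>i. 1 / d $ i)"
  have pos: "d $ i > 0" if "i < n" for i using d that by (auto simp: vec_less_def)
  have "diag_of_vec d * diag_of_vec e = mat_diag n (\<lambda>i. d $ i * e $ i)"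
    using d unfolding diag_of_vec_def e_def by (auto simp: mat_diag_diag)
  also have "\<dots> = 1\<^sub>m n" using pos by (intro eq_matI) (fastforce simp: mat_diag_def e_def)+
  finally have "minv (diag_of_vec d) = diag_of_vec e"
    using d by (intro minv_eqI[of _ n]) (auto simp: diag_of_vec_def e_def)
  moreover have "e \<in> carrier_vec n" by (simp add: e_def)
  ultimately show ?thesis using p by (auto simp: diag_of_vec_mult e_def)
qed

lemma vec_le_less_trans: "x \<le> y \<Longrightarrow> y <\<^sub>v z \<Longrightarrow> x <\<^sub>v z"
  by (force simp: vec_less_def less_eq_vec_def)

lemma mult_mat_vec_uminus:
  fixes A :: "real mat"
  assumes "A \<in> carrier_mat nr nc" "x \<in> carrier_vec nc"
  shows "A *\<^sub>v - x = - (A *\<^sub>v x)"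
proof (rule eq_vecI)
  fix i assume "i < dim_vec (- (A *\<^sub>v x))"
  then have i: "i < nr" using assms(1) by simp
  have "(A *\<^sub>v - x) $ i = - (A *\<^sub>v x) $ i"
    unfolding mult_mat_vec_sum[OF assms i]
      mult_mat_vec_sum[OF assms(1) uminus_carrier_vec[THEN iffD2, OF assms(2)] i]
    using assms(2) by (simp add: sum_negf)
  then show "(A *\<^sub>v - x) $ i = (- (A *\<^sub>v x)) $ i" using i assms(1) by simp
qed simp

lemma less_eq_matD:
  assumes "A \<le> B" "i < dim_row B" "j < dim_col B"
  shows "A $$ (i, j) \<le> B $$ (i, j)"
  using assms by (simp add: less_eq_mat_def)

lemma mult_mat_vec_mono:
  fixes A :: "real mat"
  assumes A: "A \<in> carrier_mat nr nc" "0\<^sub>m nr nc \<le> A"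
    and xy: "x \<in> carrier_vec nc" "y \<in> carrier_vec nc" "x \<le> y"
  shows "A *\<^sub>v x \<le> A *\<^sub>v y"
proof -
  have "(A *\<^sub>v x) $ i \<le> (A *\<^sub>v y) $ i" if "i < nr" for i
    unfolding mult_mat_vec_sum[OF A(1) xy(1) that] mult_mat_vec_sum[OF A(1) xy(2) that]
    using A xy that by (intro sum_mono mult_left_mono) (auto simp: less_eq_mat_def less_eq_vec_def)
  then show ?thesis using A by (auto simp: less_eq_vec_def)
qed

lemma mult_mat_nonneg:
  fixes A B :: "real mat"
  assumes "A \<in> carrier_mat nr n" "0\<^sub>m nr n \<le> A" "B \<in> carrier_mat n nc" "0\<^sub>m n nc \<le> B"
  shows "0\<^sub>m nr nc \<le> A * B"
  using assms by (auto simp: less_eq_mat_def scalar_prod_def intro!: sum_nonneg)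

lemma transpose_one_le:
  fixes K :: "real mat"
  assumes "K \<in> carrier_mat n n" "1\<^sub>m n \<le> K"
  shows "1\<^sub>m n \<le> transpose_mat K"
proof -
  have "1\<^sub>m n $$ (j, i) \<le> K $$ (j, i)" if "i < n" "j < n" for i j
    using assms that unfolding less_eq_mat_def by auto
  then show ?thesis using assms(1) by (fastforce simp: less_eq_mat_def)
qed

lemma one_le_mat_nonneg:
  fixes K :: "real mat"
  assumes "1\<^sub>m n \<le> K"
  shows "0\<^sub>m n n \<le> K"
proof -
  have "0\<^sub>m n n \<le> (1\<^sub>m n :: real mat)" by (auto simp: less_eq_mat_def)
  then show ?thesis using assms by (rule order_trans)
qed

text \<open>Nonnegativity of \<open>K\<close> alone preserves only the weak order. The diagonal
  entry \<open>K $$ (i, i)\<close> is at least 1, so the term \<open>j = i\<close> makes the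
  inequality in row \<open>i\<close> strict.\<close>

lemma mult_one_le_mat_vec_strict:
  fixes K :: "real mat"
  assumes K: "K \<in> carrier_mat n n" "1\<^sub>m n \<le> K"
    and x: "x \<in> carrier_vec n" and y: "y \<in> carrier_vec n" and xy: "x <\<^sub>v y"
  shows "K *\<^sub>v x <\<^sub>v K *\<^sub>v y"
proof -
  have "(K *\<^sub>v x) $ i < (K *\<^sub>v y) $ i" if i: "i < n" for i
    unfolding mult_mat_vec_sum[OF K(1) x i] mult_mat_vec_sum[OF K(1) y i]
  proof (rule sum_strict_mono_ex1)
    have "0 \<le> K $$ (i, j)" if "j < n" for j
      using one_le_mat_nonneg[OF K(2)] K i that by (auto simp: less_eq_mat_def)
    then show "\<forall>j\<in>{..<n}. K $$ (i, j) * x $ j \<le> K $$ (i, j) * y $ j"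
      using xy y by (auto simp: vec_less_def less_imp_le intro!: mult_left_mono)
    have "1 \<le> K $$ (i, i)" using less_eq_matD[OF K(2), of i i] K i by simp
    then have "K $$ (i, i) * x $ i < K $$ (i, i) * y $ i"
      using xy i y by (intro mult_strict_left_mono) (auto simp: vec_less_def)
    then show "\<exists>j\<in>{..<n}. K $$ (i, j) * x $ j < K $$ (i, j) * y $ j" using i by blast
  qed simp
  then show ?thesis using K by (auto simp: vec_less_def)
qed

text \<open>Compare \<open>K\<close> with the identity, entry by entry, against a nonnegative
  vector. With \<open>K\<close> the inverse of the transpose of \<open>C\<close>, this bounds C^T V
  by V.\<close>

lemma mult_one_le_mat_vec_ge:
  fixes K :: "real mat"
  assumes K: "K \<in> carrier_mat n n" "1\<^sub>m n \<le> K" and x: "x \<in> carrier_vec n" "0\<^sub>v n \<le> x"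
  shows "x \<le> K *\<^sub>v x"
proof -
  have "x $ i \<le> (K *\<^sub>v x) $ i" if i: "i < n" for i
  proof -
    have "x $ i = (\<Sum>j<n. if i = j then x $ j else 0)" using i by simp
    also have "\<dots> \<le> (\<Sum>j<n. K $$ (i, j) * x $ j)"
    proof (rule sum_mono)
      fix j assume "j \<in> {..<n}"
      then have "1\<^sub>m n $$ (i, j) \<le> K $$ (i, j)" "0 \<le> x $ j"
        using K x i by (auto simp: less_eq_mat_def less_eq_vec_def)
      then show "(if i = j then x $ j else 0) \<le> K $$ (i, j) * x $ j"
        using i \<open>j \<in> {..<n}\<close> mult_right_mono[of 1 "K $$ (i, j)" "x $ j"] by auto
    qed
    finally show ?thesis unfolding mult_mat_vec_sum[OF K(1) x(1) i] .
  qed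
  then show ?thesis using K x by (auto simp: less_eq_vec_def)
qed

section \<open>Feasibility\<close>

text \<open>With \<open>Q = A\<^sup>-\<^sup>1\<close>, the equation reads \<open>x = F x\<close> for the monotone map \<open>F x = V - Q [x]\<^sup>-\<^sup>1 c\<close>.
  Since \<open>F V \<le> V\<close> and, by hypothesis, \<open>F (V / 2) \<ge> V / 2\<close>, the componentwise infimum of the
  \<open>x \<ge> V / 2\<close> with \<open>F x \<le> x\<close> is a fixed point, as in the theorem of Knaster and Tarski.\<close>

lemma feasible_of_quarter_bound:
  assumes A: "A \<in> carrier_mat n n" and Q: "Q \<in> carrier_mat n n" "A * Q = 1\<^sub>m n" "0\<^sub>m n n \<le> Q"
    and b: "b \<in> carrier_vec n" "0\<^sub>v n \<le> b" and c: "c \<in> carrier_vec n" "0\<^sub>v n <\<^sub>v c"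
    and V: "V = Q *\<^sub>v b" "0\<^sub>v n <\<^sub>v V"
    and quarter: "Q *\<^sub>v (minv (diag_of_vec V) *\<^sub>v c) <\<^sub>v (1/4) \<cdot>\<^sub>v V"
  shows "feasible A b c"
proof -
  have Vc: "V \<in> carrier_vec n" using V Q b by auto
  have Vpos: "0 < V $ i" if "i < n" for i using V(2) Vc that by (auto simp: vec_less_def)
  have cpos: "0 < c $ i" if "i < n" for i using c that by (auto simp: vec_less_def)
  have Qnn: "0 \<le> Q $$ (i, j)" if "i < n" "j < n" for i j
    using Q that by (auto simp: less_eq_mat_def)
  define F where "F x i = V $ i - (\<Sum>j<n. Q $$ (i, j) * (c $ j / x j))" for x :: "nat \<Rightarrow> real" and i
  \<comment> \<open>The lower bound \<open>V $ j / 2\<close> keeps the denominators positive, so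
    that enlarging the argument shrinks the subtracted term.\<close>
  have mono: "F x i \<le> F y i"
    if "\<And>j. j < n \<Longrightarrow> V $ j / 2 \<le> x j" "\<And>j. j < n \<Longrightarrow> x j \<le> y j" "i < n" for x y i
  proof -
    have "c $ j / y j \<le> c $ j / x j" if "j < n" for j
      using cpos[OF that] Vpos[OF that] \<open>\<And>j. j < n \<Longrightarrow> V $ j / 2 \<le> x j\<close>[OF that]
        \<open>\<And>j. j < n \<Longrightarrow> x j \<le> y j\<close>[OF that] by (intro divide_left_mono) auto
    then show ?thesis unfolding F_def
      using that(3) Qnn by (intro diff_left_mono sum_mono mult_left_mono) auto
  qed
  \<comment> \<open>Origin of the factor 1/4: halving the denominators doubles the sum, which is
    below V / 4 by hypothesis, so at most V / 2 is subtracted from V.\<close>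
  have low: "V $ i / 2 \<le> F (\<lambda>j. V $ j / 2) i" if i: "i < n" for i
  proof -
    have "(\<Sum>j<n. Q $$ (i, j) * (c $ j / V $ j)) < V $ i / 4"
      using quarter i Vc Q
      by (simp add: vec_less_def minv_diag_of_vec[OF Vc V(2) c(1)] scalar_prod_def lessThan_atLeast0)
    moreover have "(\<Sum>j<n. Q $$ (i, j) * (c $ j / (V $ j / 2)))
        = 2 * (\<Sum>j<n. Q $$ (i, j) * (c $ j / V $ j))"
      unfolding sum_distrib_left by (intro sum.cong) auto
    ultimately show ?thesis unfolding F_def by linarith
  qed
  define X where "X = {x. \<forall>i<n. V $ i / 2 \<le> x i \<and> F x i \<le> x i}"
  have "0 \<le> (\<Sum>j<n. Q $$ (i, j) * (c $ j / V $ j))" if "i < n" for i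
    using Qnn[OF that] cpos Vpos
    by (intro sum_nonneg mult_nonneg_nonneg divide_nonneg_pos less_imp_le[OF cpos]) auto
  then have VX: "($) V \<in> X" unfolding X_def F_def using Vpos by fastforce
  \<comment> \<open>\<open>X\<close> contains \<open>V\<close> and is bounded below by V / 2 in
    every component \<open>i < n\<close>, so these conditional infima are meaningful.\<close>
  define l where "l i = Inf ((\<lambda>x. x i) ` X)" for i
  have l_lower: "l i \<le> x i" if "x \<in> X" "i < n" for x i
    unfolding l_def using that by (intro cInf_lower bdd_belowI[of _ "V $ i / 2"]) (auto simp: X_def)
  have l_greatest: "z \<le> l i" if "\<And>x. x \<in> X \<Longrightarrow> z \<le> x i" for z i
    unfolding l_def using that VX by (intro cInf_greatest) auto
  have l_half: "V $ i / 2 \<le> l i" if "i < n" for i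
    using that by (intro l_greatest) (auto simp: X_def)
  have Fl_le: "F l i \<le> l i" if "i < n" for i
  proof (rule l_greatest)
    fix x assume x: "x \<in> X"
    have "F l i \<le> F x i" using l_half l_lower[OF x] that by (intro mono) auto
    also have "\<dots> \<le> x i" using x that by (auto simp: X_def)
    finally show "F l i \<le> x i" .
  qed
  have Fl_half: "V $ i / 2 \<le> F l i" if "i < n" for i
    using low[OF that] mono[of "\<lambda>j. V $ j / 2" l i] l_half that by fastforce
  \<comment> \<open>Applying the monotone \<open>F\<close> to \<open>F l\<close> <= \<open>l\<close>
    gives \<open>F (F l)\<close> <= \<open>F l\<close>. So \<open>F l\<close> lies in
    \<open>X\<close>, which yields the missing inequality \<open>l\<close> <=
    \<open>F l\<close>.\<close>
  have "F l \<in> X" unfolding X_def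
    using Fl_half Fl_le by (auto intro!: mono)
  then have fix_l: "F l i = l i" if "i < n" for i
    using l_lower[of "F l" i] Fl_le that by force
  define x where "x = vec n l"
  define y where "y = vec n (\<lambda>j. c $ j / l j)"
  have lpos: "0 < l i" if "i < n" for i using l_half[OF that] Vpos[OF that] by linarith
  have x: "x \<in> carrier_vec n" "0\<^sub>v n <\<^sub>v x" using lpos by (auto simp: x_def vec_less_def)
  have y: "y \<in> carrier_vec n" by (simp add: y_def)
  have "x = V - Q *\<^sub>v y"
  proof (rule eq_vecI)
    fix i assume "i < dim_vec (V - Q *\<^sub>v y)"
    then have i: "i < n" using Q by simp
    have "x $ i = F l i" using i fix_l by (simp add: x_def)
    then show "x $ i = (V - Q *\<^sub>v y) $ i"
      using i Q Vc y by (simp add: F_def y_def scalar_prod_def lessThan_atLeast0)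
  qed (use x Q in auto)
  \<comment> \<open>Since V = Q b, the fixed point equation becomes x = Q (b - [x]^-1 c).
    Multiplying by \<open>A\<close> and then by [x] gives the equation of feasibility.\<close>
  then have "x = Q *\<^sub>v (b - y)" using V(1) mult_minus_distrib_mat_vec[OF Q(1) b(1) y] by simp
  then have "A *\<^sub>v x = (A * Q) *\<^sub>v (b - y)"
    using assoc_mult_mat_vec[OF A Q(1) minus_carrier_vec[OF b(1) y]] by simp
  then have Ax: "A *\<^sub>v x = b - y" using minus_carrier_vec[OF b(1) y] by (simp add: Q(2))
  have "diag_of_vec x *\<^sub>v (A *\<^sub>v x) - diag_of_vec b *\<^sub>v x + c = 0\<^sub>v n"
  proof (rule eq_vecI)
    fix i assume "i < dim_vec (0\<^sub>v n :: real vec)"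
    then have i: "i < n" by simp
    have "(diag_of_vec x *\<^sub>v (A *\<^sub>v x) - diag_of_vec b *\<^sub>v x + c) $ i
        = x $ i * (b $ i - c $ i / l i) - b $ i * x $ i + c $ i"
      unfolding Ax diag_of_vec_mult[OF x(1) minus_carrier_vec[OF b(1) y]]
        diag_of_vec_mult[OF b(1) x(1)]
      using i b c x by (simp add: y_def)
    also have "\<dots> = 0" using i lpos[OF i] by (simp add: x_def field_simps)
    finally show "(diag_of_vec x *\<^sub>v (A *\<^sub>v x) - diag_of_vec b *\<^sub>v x + c) $ i = 0\<^sub>v n $ i"
      using i by simp
  qed (use c in simp)
  then show ?thesis unfolding feasible_def using A b c x by blast
qed

section \<open>Minimum principle for the Laplacian\<close>

text \<open>Rows of the Laplacian sum to zero, so row \<open>v\<close> applied to \<open>z\<close>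
  is minus the weighted sum of the differences \<open>z u - z v\<close>. At a minimum all these
  terms are nonnegative, and \<open>super\<close> forces each of them to vanish; the weight of an
  edge is positive.\<close>

lemma laplacian_min_neighbour:
  assumes G: "weighted_graph V E w" and v: "v \<in> V" and e: "{v, u} \<in> E"
    and super: "0 \<le> (\<Sum>u\<in>V. laplacian V E w v u * z u)"
    and min: "\<And>u. u \<in> V \<Longrightarrow> z v \<le> z u"
  shows "u \<in> V" "z u = z v"
proof -
  define W where "W a b = (if {a, b} \<in> E then w {a, b} else 0)" for a b
  have fin: "finite V" using G by (auto simp: weighted_graph_def)
  have Wnn: "0 \<le> W a b" for a b using G by (auto simp: weighted_graph_def W_def less_imp_le)
  have "{v, u} \<in> {{u, v} |u v. u \<in> V \<and> v \<in> V \<and> u \<noteq> v}"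
    using G e unfolding weighted_graph_def by blast
  then show u: "u \<in> V" by (auto simp: doubleton_eq_iff)
  have uv: "u \<noteq> v"
    using \<open>{v, u} \<in> {{u, v} |u v. u \<in> V \<and> v \<in> V \<and> u \<noteq> v}\<close> by (auto simp: doubleton_eq_iff)
  have Wpos: "0 < W v u" using G e by (auto simp: weighted_graph_def W_def)
  have "(\<Sum>u\<in>V. laplacian V E w v u * z u)
      = laplacian V E w v v * z v + (\<Sum>u\<in>V - {v}. laplacian V E w v u * z u)"
    using fin v by (simp add: sum.remove)
  also have "laplacian V E w v v = (\<Sum>u\<in>V - {v}. W v u)"
    unfolding laplacian_def W_def Let_def by (simp add: sum_negf[symmetric]) (intro sum.cong; simp)
  also have "(\<Sum>u\<in>V - {v}. laplacian V E w v u * z u) = (\<Sum>u\<in>V - {v}. - W v u * z u)"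
    unfolding laplacian_def W_def Let_def by (intro sum.cong) auto
  also have "(\<Sum>u\<in>V - {v}. W v u) * z v + (\<Sum>u\<in>V - {v}. - W v u * z u)
      = - (\<Sum>u\<in>V - {v}. W v u * (z u - z v))"
    by (simp add: right_diff_distrib sum_subtractf sum_distrib_right sum_negf)
  finally have "(\<Sum>u\<in>V - {v}. W v u * (z u - z v)) \<le> 0" using super by linarith
  moreover have nn: "\<forall>u\<in>V - {v}. 0 \<le> W v u * (z u - z v)" using Wnn min by simp
  ultimately have "(\<Sum>u\<in>V - {v}. W v u * (z u - z v)) = 0"
    using sum_nonneg[of "V - {v}" "\<lambda>u. W v u * (z u - z v)"] by fastforce
  then have "W v u * (z u - z v) = 0"
    using sum_nonneg_eq_0_iff[of "V - {v}" "\<lambda>u. W v u * (z u - z v)"] nn fin u uv by blast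
  then show "z u = z v" using Wpos by simp
qed

text \<open>The minimal value is handed on from node to node along the path until a node of
  \<open>S\<close> is met.\<close>

lemma laplacian_min_reaches_boundary:
  assumes G: "weighted_graph V E w"
    and super: "\<And>v. v \<in> T \<Longrightarrow> 0 \<le> (\<Sum>u\<in>V. laplacian V E w v u * z u)"
    and p: "is_path V E p" "set p \<subseteq> T \<union> S" "last p \<in> S"
    and min: "\<And>u. u \<in> V \<Longrightarrow> z (hd p) \<le> z u"
  shows "\<exists>s\<in>S. z s = z (hd p)"
  using p min
proof (induction p)
  case Nil
  then show ?case by (simp add: is_path_def)
next
  case (Cons v q)
  show ?case
  \<comment> \<open>The path may meet \<open>S\<close> before its end. The induction stops at the
    first such node, because \<open>super\<close> is available on \<open>T\<close> only.\<close>
  proof (cases "v \<in> S \<or> q = []")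
    case True
    then show ?thesis using Cons.prems by auto
  next
    case False
    then have v: "v \<in> T" "v \<in> V" and q: "q \<noteq> []"
      using Cons.prems by (auto simp: is_path_def)
    have e: "{v, hd q} \<in> E" using Cons.prems(1) q by (auto simp: is_path_def hd_conv_nth)
    have eq: "z (hd q) = z v"
      using laplacian_min_neighbour(2)[OF G v(2) e super[OF v(1)]] Cons.prems(4) by simp
    have "is_path V E q" using Cons.prems(1) q unfolding is_path_def
      by (auto split: nat.splits dest: spec[of _ "Suc _"])
    then show ?thesis using Cons.IH Cons.prems q eq by auto
  qed
qed

section \<open>One step of the block Cholesky decomposition\<close>

text \<open>The invariant of the induction over the blocks. Its last clause makes the diagonal matrix
  \<open>[C\<^sup>T V\<^sub>L\<^sup>*]\<close> of the hypothesis invertible.\<close>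

definition bcd_factors :: "nat \<Rightarrow> real mat \<Rightarrow> real vec \<Rightarrow> real mat \<Rightarrow> real mat \<Rightarrow> bool" where
  "bcd_factors N A b C D \<longleftrightarrow>
     C \<in> carrier_mat N N \<and> D \<in> carrier_mat N N \<and> A = C * D * transpose_mat C \<and>
     (\<exists>K \<in> carrier_mat N N. C * K = 1\<^sub>m N \<and> 1\<^sub>m N \<le> K) \<and>
     (\<exists>G \<in> carrier_mat N N. D * G = 1\<^sub>m N \<and> 0\<^sub>m N N \<le> G) \<and>
     (\<forall>x \<in> carrier_vec N. A *\<^sub>v x = b \<longrightarrow> 0\<^sub>v N <\<^sub>v transpose_mat C *\<^sub>v x)"

section \<open>Block inverses and the Schur complement\<close>

lemma transpose_inverse_symmetric:
  fixes A :: "real mat"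
  assumes A: "A \<in> carrier_mat n n" "transpose_mat A = A"
    and P: "P \<in> carrier_mat n n" "A * P = 1\<^sub>m n"
  shows "transpose_mat P = P"
proof -
  have "transpose_mat P * A = 1\<^sub>m n"
    using transpose_mult[OF A(1) P(1)] A P by simp
  then show ?thesis using inverse_mat_unique[OF A(1) P(1) _ P(2)] P by simp
qed

lemma four_block_one_mat: "four_block_mat (1\<^sub>m m) (0\<^sub>m m l) (0\<^sub>m l m) (1\<^sub>m l) = 1\<^sub>m (m + l)"
  by (rule eq_matI) auto

lemma four_block_mat_nonneg:
  fixes A :: "real mat"
  assumes "A \<in> carrier_mat m m" "D \<in> carrier_mat l l" "0\<^sub>m m m \<le> A" "0\<^sub>m l l \<le> D"
  shows "0\<^sub>m (m + l) (m + l) \<le> four_block_mat A (0\<^sub>m m l) (0\<^sub>m l m) D"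
  using assms by (auto simp: less_eq_mat_def)

lemma one_le_four_block_mat:
  fixes K :: "real mat"
  assumes "K \<in> carrier_mat m m" "B \<in> carrier_mat l m" "1\<^sub>m m \<le> K" "0\<^sub>m l m \<le> B"
  shows "1\<^sub>m (m + l) \<le> four_block_mat K (0\<^sub>m m l) B (1\<^sub>m l)"
proof -
  have "(if i = j then 1 else 0) \<le> K $$ (i, j)" if "i < m" "j < m" for i j
    using less_eq_matD[OF assms(3), of i j] assms(1) that by simp
  moreover have "0 \<le> B $$ (i, j)" if "i < l" "j < m" for i j
    using less_eq_matD[OF assms(4), of i j] assms(2) that by simp
  ultimately show ?thesis using assms(1,2) by (auto simp: less_eq_mat_def)
qed

text \<open>The lower left block of the product is B C K - B, and C K is the identity. In the
  decomposition \<open>B\<close> is \<open>al * P\<close>, so the inverse of the unit lower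
  triangular factor has \<open>- (al * P)\<close> there.\<close>

lemma unit_lower_block_inverse:
  fixes C :: "real mat"
  assumes C: "C \<in> carrier_mat m m" and B: "B \<in> carrier_mat l m"
    and K: "K \<in> carrier_mat m m" "C * K = 1\<^sub>m m"
  shows "four_block_mat C (0\<^sub>m m l) (B * C) (1\<^sub>m l) * four_block_mat K (0\<^sub>m m l) (- B) (1\<^sub>m l)
    = 1\<^sub>m (m + l)"
proof -
  have "B * C * K = B" using assoc_mult_mat[OF B C K(1)] K(2) B by simp
  moreover have "B + - B = 0\<^sub>m l m" "1\<^sub>m m + - 0\<^sub>m m m = (1\<^sub>m m :: real mat)"
    using B by (auto intro!: eq_matI)
  ultimately show ?thesis
    using mult_four_block_mat[OF C zero_carrier_mat[of m l] mult_carrier_mat[OF B C]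
        one_carrier_mat[of l] K(1) zero_carrier_mat[of m l] uminus_carrier_mat[OF B]
        one_carrier_mat[of l]] K(2) B C K(1)
    by (simp add: four_block_one_mat del: assoc_mult_mat)
qed

lemma four_block_mat_eqD:
  assumes eq: "four_block_mat A B C D = four_block_mat A' B' C' D'"
    and c: "A \<in> carrier_mat m m" "B \<in> carrier_mat m l" "D \<in> carrier_mat l l"
      "A' \<in> carrier_mat m m" "B' \<in> carrier_mat m l" "D' \<in> carrier_mat l l"
  shows "B = B'" "D = D'"
proof -
  show "B = B'"
  proof (rule eq_matI)
    fix i j assume "i < dim_row B'" "j < dim_col B'"
    then show "B $$ (i, j) = B' $$ (i, j)"
      using arg_cong[OF eq, of "\<lambda>X. X $$ (i, m + j)"] c by simp
  qed (use c in auto)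
  show "D = D'"
  proof (rule eq_matI)
    fix i j assume "i < dim_row D'" "j < dim_col D'"
    then show "D $$ (i, j) = D' $$ (i, j)"
      using arg_cong[OF eq, of "\<lambda>X. X $$ (m + i, m + j)"] c by simp
  qed (use c in auto)
qed

text \<open>The right block column of the product gives A' Q2 + B Q4 = 0 and al Q2 + a Q4 = I.
  Solving the first equation for Q2 = - P B Q4 and inserting this in the second eliminates
  \<open>Q2\<close>.\<close>

lemma schur_complement_inverse:
  fixes A' :: "real mat"
  assumes A': "A' \<in> carrier_mat m m" and B: "B \<in> carrier_mat m l"
    and al: "al \<in> carrier_mat l m" and a: "a \<in> carrier_mat l l"
    and P: "P \<in> carrier_mat m m" "A' * P = 1\<^sub>m m"
    and Qc: "Q1 \<in> carrier_mat m m" "Q2 \<in> carrier_mat m l" "Q3 \<in> carrier_mat l m"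
      "Q4 \<in> carrier_mat l l"
    and Q: "four_block_mat A' B al a * four_block_mat Q1 Q2 Q3 Q4 = 1\<^sub>m (m + l)"
  shows "(a - al * P * B) * Q4 = 1\<^sub>m l"
proof -
  have PA': "P * A' = 1\<^sub>m m" using mat_mult_left_right_inverse[OF A' P] .
  have alP: "al * P \<in> carrier_mat l m" using al P(1) by (rule mult_carrier_mat)
  have AQ: "four_block_mat (A' * Q1 + B * Q3) (A' * Q2 + B * Q4)
      (al * Q1 + a * Q3) (al * Q2 + a * Q4)
    = four_block_mat (1\<^sub>m m) (0\<^sub>m m l) (0\<^sub>m l m) (1\<^sub>m l)"
    using Q mult_four_block_mat[OF A' B al a Qc]
    unfolding four_block_one_mat by simp
  have c1: "A' * Q2 \<in> carrier_mat m l" using A' Qc(2) by (rule mult_carrier_mat)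
  have c2: "B * Q4 \<in> carrier_mat m l" using B Qc(4) by (rule mult_carrier_mat)
  have "A' * Q1 + B * Q3 \<in> carrier_mat m m" "al * Q2 + a * Q4 \<in> carrier_mat l l"
    using mult_carrier_mat[OF B Qc(3)] mult_carrier_mat[OF a Qc(4)] by (auto intro: add_carrier_mat)
  from four_block_mat_eqD[OF AQ this(1) add_carrier_mat[OF c2] this(2)]
  have q2: "A' * Q2 + B * Q4 = 0\<^sub>m m l" and q4: "al * Q2 + a * Q4 = 1\<^sub>m l" by simp_all
  have c3: "P * (B * Q4) \<in> carrier_mat m l" using P(1) c2 by (rule mult_carrier_mat)
  have "0\<^sub>m m l = P * (A' * Q2 + B * Q4)" using q2 P by simp
  also have "\<dots> = P * (A' * Q2) + P * (B * Q4)"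
    by (rule mult_add_distrib_mat[OF P(1) c1 c2])
  also have "P * (A' * Q2) = Q2"
    using assoc_mult_mat[OF P(1) A' Qc(2)] PA' Qc(2) by simp
  finally have "0\<^sub>m l l = al * (Q2 + P * (B * Q4))"
    using right_mult_zero_mat[OF al, of l] by simp
  also have "\<dots> = al * Q2 + al * (P * (B * Q4))"
    by (rule mult_add_distrib_mat[OF al Qc(2) c3])
  also have "al * (P * (B * Q4)) = al * P * B * Q4"
    unfolding assoc_mult_mat[OF alP B Qc(4)] assoc_mult_mat[OF al P(1) c2] ..
  finally have z: "al * Q2 + al * P * B * Q4 = 0\<^sub>m l l" by (rule sym)
  have "(a - al * P * B) * Q4 = a * Q4 - al * P * B * Q4"
    by (rule minus_mult_distrib_mat[OF a mult_carrier_mat[OF alP B] Qc(4)])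
  also have "\<dots> = al * Q2 + a * Q4 - (al * Q2 + al * P * B * Q4)"
  proof -
    have "Y - Z = X + Y - (X + Z)"
      if "X \<in> carrier_mat l l" "Y \<in> carrier_mat l l" "Z \<in> carrier_mat l l" for X Y Z :: "real mat"
      using that by (intro eq_matI) auto
    then show ?thesis
      using mult_carrier_mat[OF al Qc(2)] mult_carrier_mat[OF a Qc(4)]
        mult_carrier_mat[OF mult_carrier_mat[OF alP B] Qc(4)] by blast
  qed
  also have "\<dots> = 1\<^sub>m l" unfolding z q4 by (intro eq_matI) auto
  finally show ?thesis .
qed

text \<open>The inverse of the Schur complement is a block of the inverse of the whole matrix, hence
  nonnegative; the last block of \<open>C\<^sup>T x\<close> is that of \<open>x\<close>, whereas the first block of \<open>C\<^sup>T x\<close> is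
  \<open>C'\<^sup>T x'\<close> for the solution \<open>x'\<close> of the smaller system \<open>A' x' = b'\<close>.\<close>

lemma bcd_factors_step:
  assumes A': "A' \<in> carrier_mat m m" "transpose_mat A' = A'"
    and al: "al \<in> carrier_mat l m" "al \<le> 0\<^sub>m l m" and a: "a \<in> carrier_mat l l"
    and A: "A = four_block_mat A' (transpose_mat al) al a"
    and P: "P \<in> carrier_mat m m" "A' * P = 1\<^sub>m m" "0\<^sub>m m m \<le> P"
    and Q: "Q \<in> carrier_mat (m + l) (m + l)" "A * Q = 1\<^sub>m (m + l)" "0\<^sub>m (m + l) (m + l) \<le> Q"
    and b: "b' \<in> carrier_vec m" "b'' \<in> carrier_vec l"
    and pos: "\<And>x. x \<in> carrier_vec (m + l) \<Longrightarrow> A *\<^sub>v x = b' @\<^sub>v b'' \<Longrightarrow> 0\<^sub>v (m + l) <\<^sub>v x"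
    and IH: "bcd_factors m A' b' C' D'"
  shows "bcd_factors (m + l) A (b' @\<^sub>v b'')
     (four_block_mat C' (0\<^sub>m m l) (al * P * C') (1\<^sub>m l))
     (four_block_mat D' (0\<^sub>m m l) (0\<^sub>m l m) (a - al * P * transpose_mat al))"
proof -
  let ?C = "four_block_mat C' (0\<^sub>m m l) (al * P * C') (1\<^sub>m l)"
  define S where "S = a - al * P * transpose_mat al"
  let ?D = "four_block_mat D' (0\<^sub>m m l) (0\<^sub>m l m) S"
  from IH obtain K G where C': "C' \<in> carrier_mat m m" and D': "D' \<in> carrier_mat m m"
    and A'eq: "A' = C' * D' * transpose_mat C'"
    and K: "K \<in> carrier_mat m m" "C' * K = 1\<^sub>m m" "1\<^sub>m m \<le> K"
    and G: "G \<in> carrier_mat m m" "D' * G = 1\<^sub>m m" "0\<^sub>m m m \<le> G"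
    and u': "\<And>x. x \<in> carrier_vec m \<Longrightarrow> A' *\<^sub>v x = b' \<Longrightarrow> 0\<^sub>v m <\<^sub>v transpose_mat C' *\<^sub>v x"
    unfolding bcd_factors_def by blast
  have PA': "P * A' = 1\<^sub>m m" using mat_mult_left_right_inverse[OF A'(1) P(1,2)] .
  have Pt: "transpose_mat P = P" using transpose_inverse_symmetric[OF A' P(1,2)] .
  have alT: "transpose_mat al \<in> carrier_mat m l" using al by simp
  have alP: "al * P \<in> carrier_mat l m" and alPC: "al * P * C' \<in> carrier_mat l m"
    using al P C' by auto
  have S: "S \<in> carrier_mat l l"
    unfolding S_def by (rule minus_carrier_mat[OF mult_carrier_mat[OF alP alT]])
  have C'T: "transpose_mat C' \<in> carrier_mat m m" using C' by simp
  have alPC_T: "transpose_mat (al * P * C') = transpose_mat C' * (P * transpose_mat al)"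
    using transpose_mult[OF alP C'] transpose_mult[OF al(1) P(1)] Pt by simp
  have C: "?C \<in> carrier_mat (m + l) (m + l)" and D: "?D \<in> carrier_mat (m + l) (m + l)"
    using C' D' S by auto

  note mc = mult_carrier_mat[of _ m m _ m] mult_carrier_mat[of _ m m _ l]
    mult_carrier_mat[of _ l m _ m] mult_carrier_mat[of _ l m _ l]
  note assoc = assoc_mult_mat[of _ m m _ m _ m] assoc_mult_mat[of _ m m _ m _ l]
    assoc_mult_mat[of _ l m _ m _ m] assoc_mult_mat[of _ l m _ m _ l]
  have CT: "transpose_mat ?C
      = four_block_mat (transpose_mat C') (transpose_mat C' * (P * transpose_mat al)) (0\<^sub>m l m) (1\<^sub>m l)"
    using transpose_four_block_mat[OF C' zero_carrier_mat alPC one_carrier_mat] alPC_T by simp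
  have CD: "?C * ?D = four_block_mat (C' * D') (0\<^sub>m m l) (al * P * C' * D') S"
    using mult_four_block_mat[OF C' zero_carrier_mat[of m l] alPC one_carrier_mat[of l] D'
        zero_carrier_mat[of m l] zero_carrier_mat[of l m] S]
      C' D' S al(1) alPC mult_carrier_mat[OF C' D'] mult_carrier_mat[OF alPC D']
    by (simp del: assoc_mult_mat)
  \<comment> \<open>The remaining blocks of the product are checked in \<open>e2\<close>,
    \<open>e3\<close> and \<open>e4\<close>. In each of them C' D' C'^T recombines to
    \<open>A'\<close> and cancels against \<open>P\<close>.\<close>
  have e2: "C' * D' * (transpose_mat C' * (P * transpose_mat al)) = transpose_mat al"
  proof -
    have "C' * D' * (transpose_mat C' * (P * transpose_mat al)) = A' * (P * transpose_mat al)"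
      unfolding A'eq using C' D' P alT by (simp add: mc assoc)
    also have "\<dots> = A' * P * transpose_mat al"
      by (rule assoc_mult_mat[OF A'(1) P(1) alT, symmetric])
    finally show ?thesis using alT P(2) by simp
  qed
  have e3: "al * P * C' * D' * transpose_mat C' = al"
  proof -
    have "al * P * C' * D' * transpose_mat C' = al * (P * A')"
      unfolding A'eq using al P C' D' by (simp add: mc assoc)
    then show ?thesis using PA' al by simp
  qed
  have e4: "al * P * C' * D' * (transpose_mat C' * (P * transpose_mat al)) + S = a"
  proof -
    have "al * P * C' * D' * (transpose_mat C' * (P * transpose_mat al))
        = al * P * (C' * D' * (transpose_mat C' * (P * transpose_mat al)))"
      using al P C' D' alT by (simp add: mc assoc)
    then have "al * P * C' * D' * (transpose_mat C' * (P * transpose_mat al))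
        = al * P * transpose_mat al" unfolding e2 .
    moreover have "al * P * transpose_mat al \<in> carrier_mat l l"
      by (rule mult_carrier_mat[OF alP alT])
    ultimately show ?thesis using a unfolding S_def by (intro eq_matI) auto
  qed
  have "?C * ?D * transpose_mat ?C = A"
  proof -
    have c: "C' * D' \<in> carrier_mat m m" "al * P * C' * D' \<in> carrier_mat l m"
      "transpose_mat C' * (P * transpose_mat al) \<in> carrier_mat m l"
      using C' D' al P alT by (simp_all add: mc)
    show ?thesis unfolding CD CT A
      using mult_four_block_mat[OF c(1) zero_carrier_mat[of m l] c(2) S C'T c(3)
          zero_carrier_mat[of l m] one_carrier_mat[of l]] e2 e3 e4 A'eq A' al alT S c
      by simp
  qed
  moreover have "\<exists>K \<in> carrier_mat (m + l) (m + l). ?C * K = 1\<^sub>m (m + l) \<and> 1\<^sub>m (m + l) \<le> K"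
  proof (intro bexI conjI)
    let ?K = "four_block_mat K (0\<^sub>m m l) (- (al * P)) (1\<^sub>m l)"
    show "?K \<in> carrier_mat (m + l) (m + l)" using K by auto
    show "?C * ?K = 1\<^sub>m (m + l)" by (rule unit_lower_block_inverse[OF C' alP K(1,2)])
    \<comment> \<open>Here the sign of the off-diagonal entries enters: \<open>al\<close> is
      nonpositive and \<open>P\<close> nonnegative, so the new block of the inverse of C is
      nonnegative.\<close>
    have "0\<^sub>m l m \<le> - al" using al by (auto simp: less_eq_mat_def)
    then have "0\<^sub>m l m \<le> - al * P" using al P by (intro mult_mat_nonneg) auto
    then have "0\<^sub>m l m \<le> - (al * P)" using al(1) P(1) by simp
    then show "1\<^sub>m (m + l) \<le> ?K" using K alP by (intro one_le_four_block_mat) auto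
  qed
  moreover have "\<exists>G \<in> carrier_mat (m + l) (m + l). ?D * G = 1\<^sub>m (m + l) \<and> 0\<^sub>m (m + l) (m + l) \<le> G"
  proof -
    obtain Q1 Q2 Q3 Q4 where sp: "split_block Q m m = (Q1, Q2, Q3, Q4)" by (metis prod_cases4)
    note Qi = split_block[OF sp, of l l]
    have Qc: "Q1 \<in> carrier_mat m m" "Q2 \<in> carrier_mat m l" "Q3 \<in> carrier_mat l m"
      "Q4 \<in> carrier_mat l l" and Qeq: "Q = four_block_mat Q1 Q2 Q3 Q4"
      using Qi Q by auto
    have SQ4: "S * Q4 = 1\<^sub>m l"
      unfolding S_def using schur_complement_inverse[OF A'(1) alT al(1) a P(1,2) Qc] Q(2)
      unfolding A Qeq by simp
    let ?G = "four_block_mat G (0\<^sub>m m l) (0\<^sub>m l m) Q4"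
    have "0 \<le> Q4 $$ (i, j)" if "i < l" "j < l" for i j
      using less_eq_matD[OF Q(3), of "m + i" "m + j"] Q(1) Qc that by (simp add: Qeq)
    then have "0\<^sub>m l l \<le> Q4" using Qc by (auto simp: less_eq_mat_def)
    then have "0\<^sub>m (m + l) (m + l) \<le> ?G" using G Qc by (intro four_block_mat_nonneg) auto
    moreover have "?D * ?G = 1\<^sub>m (m + l)"
      using mult_four_block_mat[OF D' zero_carrier_mat[of m l] zero_carrier_mat[of l m] S G(1)
          zero_carrier_mat[of m l] zero_carrier_mat[of l m] Qc(4)] G(2) SQ4 D' S G(1) Qc
      by (simp add: four_block_one_mat)
    moreover have "?G \<in> carrier_mat (m + l) (m + l)" using G Qc by auto
    ultimately show ?thesis by blast
  qed
  moreover have "0\<^sub>v (m + l) <\<^sub>v transpose_mat ?C *\<^sub>v x"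
    if x: "x \<in> carrier_vec (m + l)" and Ax: "A *\<^sub>v x = b' @\<^sub>v b''" for x
  proof -
    define x1 x2 where "x1 = vec_first x m" and "x2 = vec_last x l"
    have xc: "x1 \<in> carrier_vec m" "x2 \<in> carrier_vec l" and xeq: "x = x1 @\<^sub>v x2"
      using x by (auto simp: x1_def x2_def)
    have x2pos: "0 < x2 $ i" if "i < l" for i
      using pos[OF x Ax] that xc by (auto simp: vec_less_def xeq dest!: spec[of _ "m + i"])
    have alx2: "transpose_mat al *\<^sub>v x2 \<in> carrier_vec m"
      using alT xc(2) by (rule mult_mat_vec_carrier)
    have Px2: "P *\<^sub>v (transpose_mat al *\<^sub>v x2) \<in> carrier_vec m"
      using P(1) alx2 by (rule mult_mat_vec_carrier)
    have "A' *\<^sub>v x1 + transpose_mat al *\<^sub>v x2 = b'"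
      using Ax A' alT al a b xc unfolding A xeq
      by (subst (asm) four_block_mat_mult_vec[OF A'(1) alT al(1) a xc])
        (subst (asm) append_vec_eq[of _ m], auto)
    \<comment> \<open>The first block row says A' x1 + al^T x2 = b'. Writing al^T x2 as A' P al^T x2
      absorbs it into the argument of \<open>A'\<close>, which exhibits the solution of the smaller
      system.\<close>
    moreover have "A' *\<^sub>v (x1 + P *\<^sub>v (transpose_mat al *\<^sub>v x2))
        = A' *\<^sub>v x1 + A' * P *\<^sub>v (transpose_mat al *\<^sub>v x2)"
      using mult_add_distrib_mat_vec[OF A'(1) xc(1) Px2] assoc_mult_mat_vec[OF A'(1) P(1) alx2]
      by simp
    ultimately have "A' *\<^sub>v (x1 + P *\<^sub>v (transpose_mat al *\<^sub>v x2)) = b'"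
      using alx2 by (simp add: P(2))
    then have u1: "0\<^sub>v m <\<^sub>v transpose_mat C' *\<^sub>v (x1 + P *\<^sub>v (transpose_mat al *\<^sub>v x2))"
      using xc Px2 by (intro u') auto
    have c: "transpose_mat C' * (P * transpose_mat al) \<in> carrier_mat m l" using C' P alT by (simp add: mc)
    have "transpose_mat ?C *\<^sub>v x = (transpose_mat C' *\<^sub>v x1
        + transpose_mat C' * (P * transpose_mat al) *\<^sub>v x2) @\<^sub>v (0\<^sub>m l m *\<^sub>v x1 + 1\<^sub>m l *\<^sub>v x2)"
      unfolding CT xeq by (rule four_block_mat_mult_vec[OF C'T c _ _ xc]) auto
    also have "transpose_mat C' *\<^sub>v x1 + transpose_mat C' * (P * transpose_mat al) *\<^sub>v x2
        = transpose_mat C' *\<^sub>v (x1 + P *\<^sub>v (transpose_mat al *\<^sub>v x2))"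
      unfolding mult_add_distrib_mat_vec[OF C'T xc(1) Px2]
        assoc_mult_mat_vec[OF C'T mult_carrier_mat[OF P(1) alT] xc(2)]
        assoc_mult_mat_vec[OF P(1) alT xc(2)] ..
    also have "0\<^sub>m l m *\<^sub>v x1 + 1\<^sub>m l *\<^sub>v x2 = x2" using xc by (intro eq_vecI) auto
    finally show ?thesis
      using u1 x2pos C' xc by (auto simp: vec_less_def)
  qed
  ultimately show ?thesis unfolding bcd_factors_def S_def[symmetric] using C D by simp
qed

section \<open>Descending the hierarchy of microgrids\<close>

locale microgrid =
  fixes V L S :: "'v set" and E :: "'v set set" and w :: "'v set \<Rightarrow> real"
    and k :: nat and M :: "nat \<Rightarrow> 'v set" and ls ss :: "'v list" and VS :: "real vec"
  assumes graph: "weighted_graph V E w"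
    and LS: "L \<union> S = V" "L \<inter> S = {}"
    and cover: "(\<Union>s \<in> {1..k}. M s) = V" and disj: "disjoint_family_on M {1..k}"
    and desc: "\<forall>v \<in> L. \<exists>p. is_path V E p \<and> hd p = v \<and> last p \<in> S \<and> descends k M p"
    and ls: "distinct ls" "set ls = L" "ordered_by_microgrid k M ls"
    and ss: "distinct ss" "set ss = S"
    and VS: "VS \<in> carrier_vec (length ss)" "0\<^sub>v (length ss) <\<^sub>v VS"
begin

definition Y where "Y = laplacian V E w"
definition A where "A = matrix_on ls ls Y"
definition b where "b = - (matrix_on ls ss Y *\<^sub>v VS)"
definition n where "n i = card (M i \<inter> L)"

lemma A_carrier: "A \<in> carrier_mat (length ls) (length ls)"
  by (simp add: A_def matrix_on_def)

lemma b_carrier: "b \<in> carrier_vec (length ls)"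
  by (simp add: b_def matrix_on_def carrier_vecI)

lemma fin: "finite V" "finite L" "finite S"
  using graph LS by (auto simp: weighted_graph_def dest: finite_subset)

lemma Y_sym: "Y u v = Y v u"
  by (cases "u = v") (simp_all add: Y_def laplacian_def insert_commute)

lemma Y_nonpos: "u \<noteq> v \<Longrightarrow> Y u v \<le> 0"
  using graph by (auto simp: Y_def laplacian_def weighted_graph_def less_imp_le)

section \<open>Positions of the microgrids in the list of loads\<close>

lemma offset_Suc: "offset n (Suc i) = offset n i + n (Suc i)"
  by (simp add: offset_def)

lemma card_loads_upto:
  assumes "i \<le> k"
  shows "card ((\<Union>s\<in>{1..i}. M s) \<inter> L) = offset n i"
proof -
  have "card (\<Union>s\<in>{1..i}. M s \<inter> L) = (\<Sum>s\<in>{1..i}. card (M s \<inter> L))"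
  proof (intro card_UN_disjoint ballI impI)
    fix s t assume st: "s \<in> {1..i}" "t \<in> {1..i}" "s \<noteq> t"
    have "M s \<inter> M t = {}" by (rule disjoint_family_onD[OF disj]) (use st assms in auto)
    then show "(M s \<inter> L) \<inter> (M t \<inter> L) = {}" by blast
  qed (use fin in auto)
  then show ?thesis by (simp add: offset_def n_def Int_UN_distrib2)
qed

text \<open>Since \<open>ls\<close> is ordered by microgrid, the positions of the loads of the first
  \<open>i\<close> microgrids form a downward closed set. A finite set of this kind is an initial
  segment, and its length is its cardinality \<open>offset n i\<close>.\<close>

lemma less_offset_iff:
  assumes i: "i \<le> k" and p: "p < length ls"
  shows "p < offset n i \<longleftrightarrow> (\<exists>s\<in>{1..i}. ls ! p \<in> M s)"
proof -
  define J where "J = {p. p < length ls \<and> (\<exists>s\<in>{1..i}. ls ! p \<in> M s)}"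
  have "(\<Union>s\<in>{1..i}. M s) \<inter> L = (!) ls ` J"
    unfolding J_def ls(2)[symmetric] by (force simp: in_set_conv_nth)
  moreover have "inj_on ((!) ls) J" using ls(1) by (auto simp: J_def inj_on_nth)
  ultimately have card: "card J = offset n i" using card_loads_upto[OF i] by (simp add: card_image)
  have down: "q \<in> J" if rq: "r \<in> J" "q \<le> r" for q r
  proof (cases "q = r")
    case False
    obtain s where s: "s \<in> {1..i}" "ls ! r \<in> M s" "r < length ls" using rq(1) by (auto simp: J_def)
    then have "ls ! q \<in> set ls" using rq by simp
    then have "ls ! q \<in> V" using ls(2) LS(1) by blast
    then obtain t where t: "t \<in> {1..k}" "ls ! q \<in> M t" using cover by blast
    have sk: "s \<in> {1..k}" using s(1) i by simp
    have "q < r" using rq(2) False by simp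
    then have "t \<le> s"
      using ls(3) t sk s(2,3) unfolding ordered_by_microgrid_def by blast
    then show ?thesis using s t rq by (auto simp: J_def)
  qed (use rq in simp)
  have "finite J" by (simp add: J_def)
  have "J = {..<card J}"
  proof (cases "J = {}")
    case False
    have "J = {..Max J}" using down[OF Max_in[OF \<open>finite J\<close> False]] \<open>finite J\<close> by auto
    then show ?thesis by (metis card_atMost lessThan_Suc_atMost)
  qed simp
  then have "p \<in> J \<longleftrightarrow> p < offset n i" using card by auto
  then show ?thesis using p by (auto simp: J_def)
qed

lemma offset_k: "offset n k = length ls"
proof -
  have "(\<Union>s\<in>{1..k}. M s) \<inter> L = L" using cover LS by blast
  then show ?thesis using card_loads_upto[of k] ls distinct_card[of ls] by simp
qed

lemma offset_le:
  assumes "i \<le> k"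
  shows "offset n i \<le> length ls"
proof -
  have "offset n i \<le> offset n k" unfolding offset_def using assms by (intro sum_mono2) auto
  then show ?thesis by (simp add: offset_k)
qed

section \<open>Leading blocks and their minimum principle\<close>

lemma leading_carrier: "leading A n i \<in> carrier_mat (offset n i) (offset n i)"
  by (simp add: leading_def)

lemma leading_index:
  assumes "i \<le> k" "p < offset n i" "q < offset n i"
  shows "leading A n i $$ (p, q) = Y (ls ! p) (ls ! q)"
  using assms offset_le[OF assms(1)] by (simp add: leading_def A_def matrix_on_def)

text \<open>A descending path that starts in one of the first \<open>i\<close> microgrids never
  enters a later one, so its loads all belong to the leading block.\<close>

lemma path_below:
  assumes i: "i \<le> k" and q: "q < offset n i"
  obtains p where "is_path V E p" "hd p = ls ! q" "last p \<in> S"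
    "set p \<subseteq> (!) ls ` {..<offset n i} \<union> S"
proof -
  have ql: "q < length ls" using q offset_le[OF i] by simp
  then obtain s where s: "s \<in> {1..i}" "ls ! q \<in> M s" using less_offset_iff[OF i] q by blast
  obtain p where p: "is_path V E p" "hd p = ls ! q" "last p \<in> S" "descends k M p"
    using desc ls(2) ql nth_mem by metis
  have "u \<in> (!) ls ` {..<offset n i}" if u: "u \<in> set p" "u \<notin> S" for u
  proof -
    obtain a where a: "a < length p" "u = p ! a" using u by (metis in_set_conv_nth)
    have "u \<in> V" using p(1) u by (auto simp: is_path_def)
    then obtain t where t: "t \<in> {1..k}" "u \<in> M t" using cover by blast
    obtain r where r: "r < length ls" "u = ls ! r"
      using \<open>u \<in> V\<close> u LS(1) ls(2) by (metis UnE in_set_conv_nth)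
    have p0: "p ! 0 = ls ! q" using p(1,2) by (simp add: is_path_def hd_conv_nth)
    have "\<exists>t\<in>{1..i}. u \<in> M t"
    \<comment> \<open>\<open>descends\<close> compares strictly increasing positions only, so the
      start of the path is treated separately.\<close>
    proof (cases "a = 0")
      case True
      then show ?thesis using s p0 a by auto
    next
      case False
      have "s \<in> {1..k}" using s(1) i by simp
      moreover have "0 < a" using False by simp
      ultimately have "t \<le> s" using p(4) s(2) t a unfolding descends_def p0[symmetric] by blast
      then show ?thesis using s t by auto
    qed
    then show ?thesis using less_offset_iff[OF i r(1)] r by auto
  qed
  then show ?thesis using p that by blast
qed

text \<open>\<open>z\<close> extends \<open>x\<close> to all nodes, by \<open>c\<close> on the sources and by \<open>0\<close> on the remaining loads.\<close>

lemma leading_min_principle: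
  assumes i: "i \<le> k" and x: "x \<in> carrier_vec (offset n i)"
    and super: "\<And>p. p < offset n i \<Longrightarrow>
      0 \<le> (leading A n i *\<^sub>v x) $ p + (\<Sum>u\<in>S. Y (ls ! p) u * c u)"
    and c: "\<And>u. u \<in> S \<Longrightarrow> 0 \<le> c u"
    and p: "p < offset n i"
  shows "0 \<le> x $ p" "(\<And>u. u \<in> S \<Longrightarrow> 0 < c u) \<Longrightarrow> 0 < x $ p"
proof -
  define N where "N = offset n i"
  have N: "N \<le> length ls" using offset_le[OF i] by (simp add: N_def)
  define z where "z u = (if u \<in> S then c u else (\<Sum>q<N. if ls ! q = u then x $ q else 0))" for u
  have nS: "ls ! r \<notin> S" if "r < length ls" for r
    using nth_mem[OF that] ls(2) LS(2) by blast
  have z_ls: "z (ls ! r) = (if r < N then x $ r else 0)" if r: "r < length ls" for r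
  proof -
    have "(\<Sum>q<N. if ls ! q = ls ! r then x $ q else 0) = (\<Sum>q<N. if q = r then x $ q else 0)"
      using r N ls(1) by (intro sum.cong) (auto simp: nth_eq_iff_index_eq)
    then show ?thesis using nS[OF r] by (simp add: z_def)
  qed
  \<comment> \<open>In a row of the leading block, the loads outside it contribute nothing because
    \<open>z\<close> is 0 there; what remains is the quantity in \<open>super\<close>.\<close>
  have super_z: "0 \<le> (\<Sum>u\<in>V. laplacian V E w v u * z u)" if v: "v \<in> (!) ls ` {..<N}" for v
  proof -
    obtain r where r: "r < N" "v = ls ! r" using v by blast
    have "(\<Sum>u\<in>L. Y v u * z u) = (\<Sum>q<length ls. Y v (ls ! q) * z (ls ! q))"
      by (rule sum.reindex_bij_betw[symmetric, OF bij_betw_nth]) (use ls in auto)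
    also have "\<dots> = (\<Sum>q<length ls. if q < N then Y v (ls ! q) * x $ q else 0)"
      by (intro sum.cong) (auto simp: z_ls)
    also have "\<dots> = (\<Sum>q<N. Y v (ls ! q) * x $ q)"
      using N by (intro sum.mono_neutral_cong_right) auto
    also have "\<dots> = (leading A n i *\<^sub>v x) $ r"
      using r mult_mat_vec_sum[OF leading_carrier x] leading_index[OF i] by (simp add: N_def)
    finally have "(\<Sum>u\<in>L. Y v u * z u) = (leading A n i *\<^sub>v x) $ r" .
    moreover have "(\<Sum>u\<in>S. Y v u * z u) = (\<Sum>u\<in>S. Y v u * c u)"
      by (intro sum.cong) (auto simp: z_def)
    moreover have "(\<Sum>u\<in>V. Y v u * z u) = (\<Sum>u\<in>L. Y v u * z u) + (\<Sum>u\<in>S. Y v u * z u)"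
      using LS fin by (metis sum.union_disjoint)
    ultimately show ?thesis using super[of r] r by (simp add: Y_def N_def)
  qed
  have reach: "\<exists>s\<in>S. z s = z (ls ! q)" if q: "q < N" "\<And>u. u \<in> V \<Longrightarrow> z (ls ! q) \<le> z u" for q
  proof -
    obtain \<pi> where \<pi>: "is_path V E \<pi>" "hd \<pi> = ls ! q" "last \<pi> \<in> S" "set \<pi> \<subseteq> (!) ls ` {..<N} \<union> S"
      using path_below[OF i, of q] q(1) unfolding N_def by blast
    show ?thesis
      using laplacian_min_reaches_boundary[OF graph super_z \<pi>(1,4,3)] q(2) \<pi>(2) by simp
  qed
  have pl: "p < length ls" using p N by (simp add: N_def)
  have lsV: "ls ! r \<in> V" if "r < length ls" for r using nth_mem[OF that] ls(2) LS(1) by blast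
  then have "V \<noteq> {}" using pl by blast
  then have "Min (z ` V) \<in> z ` V" using fin(1) by (intro Min_in) auto
  then obtain v where v: "v \<in> V" and Min: "z v = Min (z ` V)" by auto
  have vmin: "z v \<le> z u" if "u \<in> V" for u using that fin(1) by (simp add: Min)
  \<comment> \<open>A global minimiser \<open>v\<close> is a source, with value \<open>c v\<close>,
    or a load of the leading block, whose value is then attained at a source, or a remaining load,
    with value 0.\<close>
  have nn: "0 \<le> z v"
  proof (cases "v \<in> S")
    case True
    then show ?thesis using c by (simp add: z_def)
  next
    case False
    then obtain r where r: "r < length ls" "v = ls ! r"
      using v LS(1) ls(2) by (metis UnE in_set_conv_nth)
    show ?thesis
    proof (cases "r < N")
      case True
      then obtain s where "s \<in> S" "z s = z v" using reach[of r] vmin r by auto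
      moreover have "z s = c s" using \<open>s \<in> S\<close> by (simp add: z_def)
      ultimately show ?thesis using c[of s] by simp
    qed (use r z_ls in simp)
  qed
  have xz: "x $ p = z (ls ! p)" using p pl z_ls by (simp add: N_def)
  show "0 \<le> x $ p" unfolding xz using nn vmin[OF lsV[OF pl]] by simp
  show "0 < x $ p" if pos: "\<And>u. u \<in> S \<Longrightarrow> 0 < c u"
  proof (rule ccontr)
    assume "\<not> 0 < x $ p"
    then have z0: "z (ls ! p) = 0" using \<open>0 \<le> x $ p\<close> xz by simp
    \<comment> \<open>If \<open>x $ p\<close> were 0, then \<open>ls ! p\<close> would itself be a
      global minimiser, and \<open>reach\<close> would produce a source on which \<open>c\<close>
      vanishes.\<close>
    then have "\<And>u. u \<in> V \<Longrightarrow> z (ls ! p) \<le> z u" using nn vmin order_trans[OF nn] by simp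
    then obtain s where "s \<in> S" "z s = 0" using reach[of p] p z0 by (auto simp: N_def)
    then show False using pos[of s] by (simp add: z_def)
  qed
qed

text \<open>The minimum principle with value 0 on all sources.\<close>

lemma leading_monotone:
  assumes i: "i \<le> k" and x: "x \<in> carrier_vec (offset n i)"
    and nn: "0\<^sub>v (offset n i) \<le> leading A n i *\<^sub>v x"
  shows "0\<^sub>v (offset n i) \<le> x"
proof -
  have "0 \<le> x $ p" if "p < offset n i" for p
    using leading_min_principle(1)[OF i x, of "\<lambda>_. 0" p] nn that leading_carrier[of i]
    by (auto simp: less_eq_vec_def)
  then show ?thesis using x by (auto simp: less_eq_vec_def)
qed

text \<open>Monotonicity applied to \<open>x\<close> and to \<open>- x\<close> shows that the kernel
  is trivial, so the inverse exists. Its columns are mapped to unit vectors, which are nonnegative,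
  so the columns are nonnegative too.\<close>

lemma leading_inverse:
  assumes i: "i \<le> k"
  defines "N \<equiv> offset n i" and "P \<equiv> minv (leading A n i)"
  shows "P \<in> carrier_mat N N" "leading A n i * P = 1\<^sub>m N" "0\<^sub>m N N \<le> P"
proof -
  let ?B = "leading A n i"
  have B: "?B \<in> carrier_mat N N" using leading_carrier by (simp add: N_def)
  have "x = 0\<^sub>v N" if x: "x \<in> carrier_vec N" "?B *\<^sub>v x = 0\<^sub>v N" for x
  proof -
    have "0\<^sub>v N \<le> x" using leading_monotone[OF i] x by (simp add: N_def)
    moreover have "0\<^sub>v N \<le> - x"
    proof -
      have "?B *\<^sub>v (- x) = - (?B *\<^sub>v x)" using B x(1) by (rule mult_mat_vec_uminus)
      then have "?B *\<^sub>v (- x) = 0\<^sub>v N" using x by simp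
      then show ?thesis using leading_monotone[OF i, of "- x"] x by (simp add: N_def)
    qed
    ultimately show ?thesis using x by (intro eq_vecI) (force simp: less_eq_vec_def)+
  qed
  then have "det ?B \<noteq> 0" using det_0_iff_vec_prod_zero_field[OF B] by blast
  then have "\<exists>Q\<in>carrier_mat N N. ?B * Q = 1\<^sub>m N"
    using det_non_zero_imp_unit[OF B, of undefined] by (auto simp: Units_def ring_mat_def)
  note inv = minv_props[OF B this]
  show P: "P \<in> carrier_mat N N" and BP: "?B * P = 1\<^sub>m N" using inv by (simp_all add: P_def)
  have "0 \<le> P $$ (p, q)" if pq: "p < N" "q < N" for p q
  proof -
    have "?B *\<^sub>v col P q = col (?B * P) q" by (rule col_mult2[OF B P pq(2), symmetric])
    then have "?B *\<^sub>v col P q = unit_vec N q" using BP pq by simp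
    then have "0\<^sub>v N \<le> col P q"
      using leading_monotone[OF i, of "col P q"] P pq
      by (simp add: N_def[symmetric]) (auto simp: less_eq_vec_def unit_vec_def)
    then show ?thesis using P pq by (auto simp: less_eq_vec_def)
  qed
  then show "0\<^sub>m N N \<le> P" using P by (auto simp: less_eq_mat_def)
qed

section \<open>The contribution of the sources\<close>

lemma b_index:
  assumes "p < length ls"
  shows "b $ p = - (\<Sum>q<length ss. Y (ls ! p) (ss ! q) * VS $ q)"
  using assms VS(1) by (simp add: b_def matrix_on_def scalar_prod_def lessThan_atLeast0)

lemma b_nonneg: "0\<^sub>v (length ls) \<le> b"
proof -
  have "0 \<le> b $ p" if p: "p < length ls" for p
  proof -
    have "Y (ls ! p) (ss ! q) * VS $ q \<le> 0" if q: "q < length ss" for q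
    proof -
      have "ls ! p \<noteq> ss ! q" using nth_mem[OF p] nth_mem[OF q] ls ss LS by auto
      then show ?thesis using Y_nonpos VS q
        by (intro mult_nonpos_nonneg) (auto simp: vec_less_def less_imp_le)
    qed
    then have "(\<Sum>q<length ss. Y (ls ! p) (ss ! q) * VS $ q) \<le> 0" by (intro sum_nonpos) auto
    then show ?thesis unfolding b_index[OF p] by simp
  qed
  then show ?thesis using b_carrier by (auto simp: less_eq_vec_def)
qed

text \<open>Take the source voltages as boundary values. As \<open>b\<close> is minus the
  contribution of the sources, the inequality required by the minimum principle holds with equality,
  and positive voltages give its strict form. In network terms, the loads of later microgrids are
  held at voltage 0.\<close>

lemma leading_solution_pos:
  assumes i: "i \<le> k" and x: "x \<in> carrier_vec (offset n i)"
    and eq: "leading A n i *\<^sub>v x = vec_first b (offset n i)"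
  shows "0\<^sub>v (offset n i) <\<^sub>v x"
proof -
  define c where "c u = (\<Sum>q<length ss. if ss ! q = u then VS $ q else 0)" for u
  have c_ss: "c (ss ! r) = VS $ r" if "r < length ss" for r
  proof -
    have "c (ss ! r) = (\<Sum>q<length ss. if q = r then VS $ q else 0)"
      unfolding c_def using that ss(1) by (intro sum.cong) (auto simp: nth_eq_iff_index_eq)
    then show ?thesis using that by simp
  qed
  have cpos: "0 < c u" if u: "u \<in> S" for u
  proof -
    obtain r where "r < length ss" "u = ss ! r" using u ss(2) by (metis in_set_conv_nth)
    then show ?thesis using c_ss VS by (auto simp: vec_less_def)
  qed
  have "(\<Sum>u\<in>S. Y v u * c u) = (\<Sum>q<length ss. Y v (ss ! q) * c (ss ! q))" for v
    by (rule sum.reindex_bij_betw[symmetric, OF bij_betw_nth]) (use ss in auto)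
  then have "(leading A n i *\<^sub>v x) $ p + (\<Sum>u\<in>S. Y (ls ! p) u * c u) = 0" if "p < offset n i" for p
    unfolding eq using that b_index[of p] offset_le[OF i] c_ss by (simp add: vec_first_def)
  then have "0 < x $ p" if "p < offset n i" for p
    using leading_min_principle(2)[OF i x, of c p] cpos that by (simp add: less_imp_le)
  then show ?thesis using x by (auto simp: vec_less_def)
qed

section \<open>Induction over the blocks\<close>

lemma alpha_carrier: "alpha A n (Suc i) \<in> carrier_mat (n (Suc i)) (offset n i)"
  by (simp add: alpha_def)

lemma block_carrier: "block A n i j \<in> carrier_mat (n i) (n j)"
  by (simp add: block_def)

lemma leading_symmetric:
  assumes i: "i \<le> k"
  shows "transpose_mat (leading A n i) = leading A n i"
proof (rule eq_matI)
  fix p q assume "p < dim_row (leading A n i)" "q < dim_col (leading A n i)"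
  then show "transpose_mat (leading A n i) $$ (p, q) = leading A n i $$ (p, q)"
    using leading_carrier[of i] leading_index[OF i] Y_sym[of "ls ! p" "ls ! q"] by auto
qed (use leading_carrier[of i] in auto)

lemma leading_Suc:
  assumes i: "Suc i \<le> k"
  shows "leading A n (Suc i) = four_block_mat (leading A n i) (transpose_mat (alpha A n (Suc i)))
    (alpha A n (Suc i)) (block A n (Suc i) (Suc i))"
proof (rule eq_matI)
  fix p q
  let ?R = "four_block_mat (leading A n i) (transpose_mat (alpha A n (Suc i)))
    (alpha A n (Suc i)) (block A n (Suc i) (Suc i))"
  assume "p < dim_row ?R" "q < dim_col ?R"
  then show "leading A n (Suc i) $$ (p, q) = ?R $$ (p, q)"
    using offset_le[OF i] offset_Suc[of i] Y_sym[of "ls ! p" "ls ! q"]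
    by (auto simp: leading_def alpha_def block_def A_def matrix_on_def)
qed (use offset_Suc[of i] in \<open>auto simp: leading_def alpha_def block_def\<close>)

lemma alpha_nonpos:
  assumes i: "Suc i \<le> k"
  shows "alpha A n (Suc i) \<le> 0\<^sub>m (n (Suc i)) (offset n i)"
  using offset_le[OF i] offset_Suc[of i] ls(1)
  by (auto simp: less_eq_mat_def alpha_def A_def matrix_on_def nth_eq_iff_index_eq intro!: Y_nonpos)

lemma bcd_factors_leading:
  assumes "i \<le> k"
  shows "bcd_factors (offset n i) (leading A n i) (vec_first b (offset n i)) (bcd_C A n i) (bcd_D A n i)"
  using assms
proof (induction i)
  case 0
  have "leading A n 0 = 1\<^sub>m 0" by (intro eq_matI) (auto simp: leading_def offset_def)
  then show ?case
    by (auto simp: bcd_factors_def offset_def less_eq_mat_def vec_less_def intro!: bexI[of _ "1\<^sub>m 0"])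
next
  case (Suc i)
  let ?N = "offset n (Suc i)"
  show ?case
  proof (cases i)
    \<comment> \<open>The first block has its own clause in \<open>bcd_C\<close> and
      \<open>bcd_D\<close>: C is the identity and D the leading block itself, so the invariant
      follows from the facts on leading blocks.\<close>
    case 0
    have N: "?N = n 1" using 0 by (simp add: offset_def)
    have B: "leading A n (Suc i) \<in> carrier_mat ?N ?N" by (rule leading_carrier)
    have C: "bcd_C A n (Suc i) = 1\<^sub>m ?N" using 0 N by simp
    have "block A n 1 1 = leading A n (Suc i)"
      by (intro eq_matI) (auto simp: block_def leading_def offset_def 0)
    then have D: "bcd_D A n (Suc i) = leading A n (Suc i)" using 0 by simp
    have "\<exists>K\<in>carrier_mat ?N ?N. 1\<^sub>m ?N * K = (1\<^sub>m ?N :: real mat) \<and> 1\<^sub>m ?N \<le> K"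
      by (rule bexI[of _ "1\<^sub>m ?N"]) auto
    moreover have "\<exists>G\<in>carrier_mat ?N ?N. leading A n (Suc i) * G = 1\<^sub>m ?N \<and> 0\<^sub>m ?N ?N \<le> G"
      using leading_inverse[OF Suc.prems] by blast
    ultimately show ?thesis
      unfolding bcd_factors_def C D using B leading_solution_pos[OF Suc.prems] by simp
  next
    case (Suc j)
    have i: "i \<le> k" using \<open>Suc i \<le> k\<close> by simp
    note P = leading_inverse[OF i] and Q = leading_inverse[OF \<open>Suc i \<le> k\<close>]
    define b'' where "b'' = vec (n (Suc i)) (\<lambda>j. b $ (offset n i + j))"
    have b: "vec_first b (offset n (Suc i)) = vec_first b (offset n i) @\<^sub>v b''"
      unfolding b''_def vec_first_def using offset_Suc[of i] by (intro eq_vecI) auto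
    have C: "bcd_C A n (Suc i) = four_block_mat (bcd_C A n i) (0\<^sub>m (offset n i) (n (Suc i)))
        (alpha A n (Suc i) * minv (leading A n i) * bcd_C A n i) (1\<^sub>m (n (Suc i)))"
      unfolding Suc by (simp only: bcd_C.simps Let_def)
    have D: "bcd_D A n (Suc i) = four_block_mat (bcd_D A n i) (0\<^sub>m (offset n i) (n (Suc i)))
        (0\<^sub>m (n (Suc i)) (offset n i)) (block A n (Suc i) (Suc i)
          - alpha A n (Suc i) * minv (leading A n i) * transpose_mat (alpha A n (Suc i)))"
      unfolding Suc by (simp only: bcd_D.simps Let_def)
    \<comment> \<open>\<open>offset_Suc\<close> is unfolded only after \<open>b\<close>, whose
      left-hand side contains \<open>offset n (Suc i)\<close>.\<close>
    show ?thesis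
      unfolding C D b unfolding offset_Suc
    proof (rule bcd_factors_step[OF leading_carrier leading_symmetric[OF i] alpha_carrier
          alpha_nonpos[OF \<open>Suc i \<le> k\<close>] block_carrier leading_Suc[OF \<open>Suc i \<le> k\<close>] P
          Q[unfolded offset_Suc] vec_first_carrier _ _ Suc.IH[OF i]])
      show "b'' \<in> carrier_vec (n (Suc i))" by (simp add: b''_def)
      show "0\<^sub>v (offset n i + n (Suc i)) <\<^sub>v x"
        if "x \<in> carrier_vec (offset n i + n (Suc i))"
          "leading A n (Suc i) *\<^sub>v x = vec_first b (offset n i) @\<^sub>v b''" for x
        using leading_solution_pos[OF \<open>Suc i \<le> k\<close>, of x] that b by (simp add: offset_Suc)
    qed
  qed
qed

section \<open>From the invariant at \<open>k\<close> to the quarter bound\<close>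

lemma leading_k: "leading A n k = A"
  using A_carrier offset_k by (intro eq_matI) (auto simp: leading_def)

lemma quarter_bound_and_feasible:
  fixes p :: "real vec"
  defines "C \<equiv> bcd_C A n k" and "D \<equiv> bcd_D A n k" and "x \<equiv> minv A *\<^sub>v b"
  assumes p: "p \<in> carrier_vec (length ls)" "0\<^sub>v (length ls) <\<^sub>v p"
    and hyp: "minv D *\<^sub>v (minv C *\<^sub>v (minv (diag_of_vec (transpose_mat C *\<^sub>v x)) *\<^sub>v p))
      <\<^sub>v (1/4) \<cdot>\<^sub>v (transpose_mat C *\<^sub>v x)"
  shows "minv A *\<^sub>v (minv (diag_of_vec x) *\<^sub>v p) <\<^sub>v (1/4) \<cdot>\<^sub>v x" "feasible A b p"
proof -
  define N where "N = length ls"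
  define Q where "Q = minv A"
  define u where "u = transpose_mat C *\<^sub>v x"
  have A: "A \<in> carrier_mat N N" and b: "b \<in> carrier_vec N" and p: "p \<in> carrier_vec N" "0\<^sub>v N <\<^sub>v p"
    unfolding N_def by (fact A_carrier b_carrier p)+
  have Q: "Q \<in> carrier_mat N N" "A * Q = 1\<^sub>m N" "0\<^sub>m N N \<le> Q"
    unfolding Q_def N_def using leading_inverse[OF order_refl] unfolding leading_k offset_k by blast+
  have x: "x \<in> carrier_vec N" using Q(1) b unfolding x_def Q_def by (rule mult_mat_vec_carrier)
  have bN: "vec_first b N = b" using b by (auto simp: vec_first_def)
  have Ax: "A *\<^sub>v x = b"
    using assoc_mult_mat_vec[OF A Q(1) b] Q(2) b by (simp add: x_def Q_def)
  have xpos: "0\<^sub>v N <\<^sub>v x"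
    using leading_solution_pos[of k x] x Ax bN by (simp add: leading_k offset_k N_def)
  have "bcd_factors N A b C D"
    using bcd_factors_leading[of k] bN by (simp add: leading_k offset_k N_def C_def D_def)
  then obtain K G where C: "C \<in> carrier_mat N N" and D: "D \<in> carrier_mat N N"
    and Aeq: "A = C * D * transpose_mat C"
    and K: "K \<in> carrier_mat N N" "C * K = 1\<^sub>m N" "1\<^sub>m N \<le> K"
    and G: "G \<in> carrier_mat N N" "D * G = 1\<^sub>m N" "0\<^sub>m N N \<le> G"
    and upos: "0\<^sub>v N <\<^sub>v u"
    using x Ax unfolding bcd_factors_def u_def by blast
  have minv_C: "minv C = K" and minv_D: "minv D = G"
    using minv_eqI C D K G by blast+
  have CT: "transpose_mat C \<in> carrier_mat N N" and KT: "transpose_mat K \<in> carrier_mat N N"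
    using C K by simp_all
  have u: "u \<in> carrier_vec N" using CT x unfolding u_def by (rule mult_mat_vec_carrier)
  have KC: "K * C = 1\<^sub>m N" using mat_mult_left_right_inverse[OF C K(1,2)] .
  have CTKT: "transpose_mat C * transpose_mat K = 1\<^sub>m N"
    using transpose_mult[OF K(1) C] KC by simp
  have KTCT: "transpose_mat K * transpose_mat C = 1\<^sub>m N"
    using transpose_mult[OF C K(1)] K(2) by simp
  have KT1: "1\<^sub>m N \<le> transpose_mat K" using transpose_one_le[OF K(1,3)] .
  \<comment> \<open>\<open>K\<close> is the inverse of \<open>C\<close>, so this recovers the
    voltages from \<open>u\<close>; as \<open>transpose_mat K\<close> dominates the identity, they
    are at least \<open>u\<close>.\<close>
  have xu: "x = transpose_mat K *\<^sub>v u"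
    unfolding u_def using assoc_mult_mat_vec[OF KT CT x] KTCT x by simp
  have "0\<^sub>v N \<le> u" using upos u by (auto simp: vec_less_def less_eq_vec_def less_imp_le)
  then have "u \<le> x" unfolding xu by (rule mult_one_le_mat_vec_ge[OF KT KT1 u])
  define q where "q = minv (diag_of_vec x) *\<^sub>v p"
  define r where "r = minv (diag_of_vec u) *\<^sub>v p"
  have q: "q = vec N (\<lambda>i. p $ i / x $ i)" and r: "r = vec N (\<lambda>i. p $ i / u $ i)"
    unfolding q_def r_def using minv_diag_of_vec x xpos u upos p by blast+
  have "q $ i \<le> r $ i" if i: "i < N" for i
  proof -
    have "u $ i \<le> x $ i" "0 < u $ i" "0 < p $ i"
      using \<open>u \<le> x\<close> x u upos p i by (auto simp: less_eq_vec_def vec_less_def)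
    then show ?thesis using i by (simp add: q r frac_le)
  qed
  then have "q \<le> r" by (simp add: less_eq_vec_def) (simp add: q r)
  have qc: "q \<in> carrier_vec N" and rc: "r \<in> carrier_vec N" by (simp_all add: q r)
  note mc = mult_mat_vec_carrier
  have "G *\<^sub>v (K *\<^sub>v q) \<le> G *\<^sub>v (K *\<^sub>v r)"
    using mult_mat_vec_mono[OF K(1) one_le_mat_nonneg[OF K(3)] qc rc \<open>q \<le> r\<close>]
    by (rule mult_mat_vec_mono[OF G(1,3) mc[OF K(1) qc] mc[OF K(1) rc]])
  moreover have "G *\<^sub>v (K *\<^sub>v r) <\<^sub>v (1/4) \<cdot>\<^sub>v u"
    using hyp unfolding minv_C minv_D r_def u_def .
  ultimately have "G *\<^sub>v (K *\<^sub>v q) <\<^sub>v (1/4) \<cdot>\<^sub>v u"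
    by (rule vec_le_less_trans)
  then have "transpose_mat K *\<^sub>v (G *\<^sub>v (K *\<^sub>v q)) <\<^sub>v transpose_mat K *\<^sub>v ((1/4) \<cdot>\<^sub>v u)"
    using mult_one_le_mat_vec_strict[OF KT KT1 mc[OF G(1) mc[OF K(1) qc]]] u by simp
  moreover have "transpose_mat K *\<^sub>v ((1/4) \<cdot>\<^sub>v u) = (1/4) \<cdot>\<^sub>v x"
    unfolding xu by (rule mult_mat_vec[OF KT u])
  \<comment> \<open>This is the factorisation of the inverse of \<open>A\<close>, checked on the
    vector \<open>q\<close>: applying the three factors of \<open>A\<close> in turn removes
    \<open>transpose_mat K\<close>, \<open>G\<close> and \<open>K\<close> one after the other, so
    that A y = q.\<close>
  moreover have "transpose_mat K *\<^sub>v (G *\<^sub>v (K *\<^sub>v q)) = Q *\<^sub>v q"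
  proof -
    define y where "y = transpose_mat K *\<^sub>v (G *\<^sub>v (K *\<^sub>v q))"
    have Kq: "K *\<^sub>v q \<in> carrier_vec N" and GKq: "G *\<^sub>v (K *\<^sub>v q) \<in> carrier_vec N"
      and y: "y \<in> carrier_vec N"
      using mc[OF K(1) qc] mc[OF G(1) mc[OF K(1) qc]] mc[OF KT mc[OF G(1) mc[OF K(1) qc]]]
      by (simp_all add: y_def)
    have "transpose_mat C *\<^sub>v y = G *\<^sub>v (K *\<^sub>v q)"
      unfolding y_def using assoc_mult_mat_vec[OF CT KT GKq] CTKT GKq by simp
    then have "D *\<^sub>v (transpose_mat C *\<^sub>v y) = K *\<^sub>v q"
      using assoc_mult_mat_vec[OF D G(1) Kq] G(2) Kq by simp
    then have "C *\<^sub>v (D *\<^sub>v (transpose_mat C *\<^sub>v y)) = q"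
      using assoc_mult_mat_vec[OF C K(1) qc] K(2) qc by simp
    then have "A *\<^sub>v y = q"
      unfolding Aeq assoc_mult_mat_vec[OF mult_carrier_mat[OF C D] CT y]
        assoc_mult_mat_vec[OF C D mc[OF CT y]] .
    then have "Q *\<^sub>v q = Q * A *\<^sub>v y" using assoc_mult_mat_vec[OF Q(1) A y] by simp
    then show ?thesis using mat_mult_left_right_inverse[OF A Q(1,2)] y by (simp add: y_def)
  qed
  ultimately have quarter: "Q *\<^sub>v q <\<^sub>v (1/4) \<cdot>\<^sub>v x" by simp
  then show "minv A *\<^sub>v (minv (diag_of_vec x) *\<^sub>v p) <\<^sub>v (1/4) \<cdot>\<^sub>v x"
    by (simp add: Q_def q_def)
  have "0\<^sub>v N \<le> b" using b_nonneg by (simp add: N_def)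
  then show "feasible A b p"
    using feasible_of_quarter_bound[OF A Q b _ p _ xpos] quarter by (simp add: x_def Q_def q_def)
qed

end

theorem theorem10:
  fixes V L S :: "'v set" and E :: "'v set set" and w :: "'v set \<Rightarrow> real"
    and k :: nat and M :: "nat \<Rightarrow> 'v set" and n :: "nat \<Rightarrow> nat"
    and ls ss :: "'v list" and Y :: "'v \<Rightarrow> 'v \<Rightarrow> real"
    and YLL YLS C D :: "real mat" and VS PL VL :: "real vec"
  assumes "weighted_graph V E w"
    and "L \<union> S = V" and "L \<inter> S = {}"
    and "(\<Union>s \<in> {1..k}. M s) = V" and "disjoint_family_on M {1..k}"
    and "\<forall>s \<in> {1..k}. M s \<inter> L \<noteq> {}"
    and "\<forall>v \<in> L. \<exists>p. is_path V E p \<and> hd p = v \<and> last p \<in> S \<and> descends k M p"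
    and "distinct ls" and "set ls = L" and "ordered_by_microgrid k M ls"
    and "distinct ss" and "set ss = S"
    and "Y = laplacian V E w"
    and "YLL = matrix_on ls ls Y" and "YLS = matrix_on ls ss Y"
    and "VS \<in> carrier_vec (length ss)" and "0\<^sub>v (length ss) <\<^sub>v VS"
    and "PL \<in> carrier_vec (length ls)" and "0\<^sub>v (length ls) <\<^sub>v PL"
    and "n = (\<lambda>i. card (M i \<inter> L))"
    and "C = bcd_C YLL n k" and "D = bcd_D YLL n k"
    and "VL = - (minv YLL *\<^sub>v (YLS *\<^sub>v VS))"
    and "minv D *\<^sub>v (minv C *\<^sub>v (minv (diag_of_vec (transpose_mat C *\<^sub>v VL)) *\<^sub>v PL))
           <\<^sub>v (1/4) \<cdot>\<^sub>v (transpose_mat C *\<^sub>v VL)"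
  shows "minv YLL *\<^sub>v (minv (diag_of_vec VL) *\<^sub>v PL) <\<^sub>v (1/4) \<cdot>\<^sub>v VL
         \<and> feasible YLL (- (YLS *\<^sub>v VS)) PL"
proof -
  interpret G: microgrid V L S E w k M ls ss VS
    by unfold_locales (fact assms)+
  have n: "n = G.n" unfolding assms(20) by (rule ext) (simp add: G.n_def)
  have YLL: "YLL = G.A" and YLS: "YLS = matrix_on ls ss G.Y"
    using assms(13-15) by (simp_all add: G.A_def G.Y_def)
  have b: "- (YLS *\<^sub>v VS) = G.b" by (simp add: G.b_def YLS)
  \<comment> \<open>The dimensions are needed to move the minus sign of \<open>VL\<close> inside the
    product, where it becomes part of \<open>G.b\<close>.\<close>
  have "minv YLL \<in> carrier_mat (length ls) (length ls)"
    using G.leading_inverse(1)[OF order_refl] by (simp add: YLL G.leading_k G.offset_k)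
  moreover have "YLS *\<^sub>v VS \<in> carrier_vec (length ls)"
    by (simp add: YLS matrix_on_def carrier_vecI)
  ultimately have "minv YLL *\<^sub>v - (YLS *\<^sub>v VS) = - (minv YLL *\<^sub>v (YLS *\<^sub>v VS))"
    by (rule mult_mat_vec_uminus)
  then have VL: "VL = minv G.A *\<^sub>v G.b" using assms(23) b YLL by simp
  show ?thesis
    using G.quarter_bound_and_feasible[OF assms(18,19)] assms(24)
    unfolding assms(21,22) n YLL b VL by blast
qed

end
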